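(* Let $k$ be an algebraically closed field with characteristic different from $2$ and $3$, and let $E/k(T)$ be an elliptic curve. Then: (a) if $E$ has non-constant $j$-invariant (i.e. $j(E)\notin k$), there are at least three points of $\mathbb{P}^1_k$ at which $E$ has bad reduction; (b) if $E$ is non-constant, there are at least two points of $\mathbb{P}^1_k$ at which $E$ has bad reduction. The bounds given in (a) and (b) are sharp: over every such $k$ there is an elliptic curve $E/k(T)$ with $j(E)\notin k$ having bad reduction at exactly three points of $\mathbb{P}^1_k$, and there is a non-constant elliptic curve $E/k(T)$ having bad reduction at exactly two points of $\mathbb{P}^1_k$.
   Context: $k(T)$ is the rational function field in one variable, identified with the function field of $\mathbb{P}^1_k$. An elliptic curve $E/k(T)$ is called constant if there exists a Weierstrass equation for $E$ with coefficients in $k$; otherwise it is non-constant. It has constant $j$-invariant if $j(E)\in k$. For a closed point $s\in\mathbb{P}^1_k$ with local ring $\mathcal{O}_{\mathbb{P}^1_k,s}$ (a discrete valuation ring with fraction field $k(T)$), $E$ has good reduction at $s$ if $E$ admits a smooth model over $\operatorname{Spec}\mathcal{O}_{\mathbb{P}^1_k,s}$ (equivalently, a minimal Weierstrass equation of $E$ over $\mathcal{O}_{\mathbb{P}^1_k,s}$ has discriminant of valuation $0$); otherwise $E$ has bad reduction at $s$. *)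

theory Defs
  imports "HOL-Computational_Algebra.Computational_Algebra"
begin

section \<open>Weierstrass equations\<close>

text \<open>
  \<open>Weierstrass a1 a2 a3 a4 a6\<close> stands for the equation
  \<open>y^2 + a1 x y + a3 y = x^3 + a2 x^2 + a4 x + a6\<close>.
\<close>

datatype 'a weierstrass =
  Weierstrass (wa1: 'a) (wa2: 'a) (wa3: 'a) (wa4: 'a) (wa6: 'a)

definition weierstrass_eval :: "'a :: comm_ring_1 weierstrass \<Rightarrow> 'a \<Rightarrow> 'a \<Rightarrow> 'a" where
  "weierstrass_eval W x y =
     y ^ 2 + wa1 W * x * y + wa3 W * y - (x ^ 3 + wa2 W * x ^ 2 + wa4 W * x + wa6 W)"

definition wb2 :: "'a :: comm_ring_1 weierstrass \<Rightarrow> 'a" where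
  "wb2 W = wa1 W ^ 2 + 4 * wa2 W"

definition wb4 :: "'a :: comm_ring_1 weierstrass \<Rightarrow> 'a" where
  "wb4 W = 2 * wa4 W + wa1 W * wa3 W"

definition wb6 :: "'a :: comm_ring_1 weierstrass \<Rightarrow> 'a" where
  "wb6 W = wa3 W ^ 2 + 4 * wa6 W"

definition wb8 :: "'a :: comm_ring_1 weierstrass \<Rightarrow> 'a" where
  "wb8 W = wa1 W ^ 2 * wa6 W + 4 * wa2 W * wa6 W - wa1 W * wa3 W * wa4 W
           + wa2 W * wa3 W ^ 2 - wa4 W ^ 2"

definition wc4 :: "'a :: comm_ring_1 weierstrass \<Rightarrow> 'a" where
  "wc4 W = wb2 W ^ 2 - 24 * wb4 W"

definition disc :: "'a :: comm_ring_1 weierstrass \<Rightarrow> 'a" where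
  "disc W = - (wb2 W ^ 2) * wb8 W - 8 * wb4 W ^ 3 - 27 * wb6 W ^ 2 + 9 * wb2 W * wb4 W * wb6 W"

definition j_invariant :: "'a :: field weierstrass \<Rightarrow> 'a" where
  "j_invariant W = wc4 W ^ 3 / disc W"

text \<open>An elliptic curve is presented by one of its Weierstrass equations.\<close>

definition elliptic_curve :: "'a :: field weierstrass \<Rightarrow> bool" where
  "elliptic_curve E \<longleftrightarrow> disc E \<noteq> 0"

text \<open>
  The equation in \<open>x', y'\<close> obtained by substituting \<open>x = u^2 x' + r\<close>,
  \<open>y = u^3 y' + s u^2 x' + t\<close> and dividing by \<open>u^6\<close>.
\<close>

definition change_coords :: "'a :: field \<Rightarrow> 'a \<Rightarrow> 'a \<Rightarrow> 'a \<Rightarrow> 'a weierstrass \<Rightarrow> 'a weierstrass" where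
  "change_coords u r s t W = Weierstrass
     ((wa1 W + 2 * s) / u)
     ((wa2 W - s * wa1 W + 3 * r - s ^ 2) / u ^ 2)
     ((wa3 W + r * wa1 W + 2 * t) / u ^ 3)
     ((wa4 W - s * wa3 W + 2 * r * wa2 W - (t + r * s) * wa1 W + 3 * r ^ 2 - 2 * s * t) / u ^ 4)
     ((wa6 W + r * wa4 W + r ^ 2 * wa2 W + r ^ 3 - t * wa3 W - t ^ 2 - r * t * wa1 W) / u ^ 6)"

lemma weierstrass_eval_change_coords:
  assumes "u \<noteq> 0"
  shows "weierstrass_eval W (u ^ 2 * x + r) (u ^ 3 * y + s * u ^ 2 * x + t) =
         u ^ 6 * weierstrass_eval (change_coords u r s t W) x y"
proof -
  define a1 a2 a3 a4 a6 where "a1 = wa1 W" "a2 = wa2 W" "a3 = wa3 W" "a4 = wa4 W" "a6 = wa6 W"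
  define V where "V = change_coords u r s t W"
  have h: "u * wa1 V = a1 + 2 * s"
    "u ^ 2 * wa2 V = a2 - s * a1 + 3 * r - s ^ 2"
    "u ^ 3 * wa3 V = a3 + r * a1 + 2 * t"
    "u ^ 4 * wa4 V = a4 - s * a3 + 2 * r * a2 - (t + r * s) * a1 + 3 * r ^ 2 - 2 * s * t"
    "u ^ 6 * wa6 V = a6 + r * a4 + r ^ 2 * a2 + r ^ 3 - t * a3 - t ^ 2 - r * t * a1"
    using assms by (simp_all add: V_def change_coords_def a1_a2_a3_a4_a6_def)
  have "u ^ 6 * weierstrass_eval V x y =
      u ^ 6 * y ^ 2 + u ^ 5 * (u * wa1 V) * x * y + u ^ 3 * (u ^ 3 * wa3 V) * y
      - (u ^ 6 * x ^ 3 + u ^ 4 * (u ^ 2 * wa2 V) * x ^ 2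
         + u ^ 2 * (u ^ 4 * wa4 V) * x + u ^ 6 * wa6 V)"
    unfolding weierstrass_eval_def by algebra
  also have "\<dots> = weierstrass_eval W (u ^ 2 * x + r) (u ^ 3 * y + s * u ^ 2 * x + t)"
    unfolding weierstrass_eval_def h a1_a2_a3_a4_a6_def by algebra
  finally show ?thesis
    by (simp add: V_def)
qed

text \<open>
  \<open>weierstrass_equation_of E W\<close>: \<open>W\<close> is a Weierstrass equation for the elliptic curve \<open>E\<close>. Any
  two Weierstrass equations of an elliptic curve over a field differ by an admissible change of
  coordinates over that field.
\<close>

definition weierstrass_equation_of :: "'a :: field weierstrass \<Rightarrow> 'a weierstrass \<Rightarrow> bool" where
  "weierstrass_equation_of E W \<longleftrightarrow> (\<exists>u r s t. u \<noteq> 0 \<and> W = change_coords u r s t E)"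


section \<open>Closed points of the projective line and their local rings\<close>

text \<open>
  The function field \<open>k(T)\<close> is the type \<^typ>\<open>'k poly fract\<close>. Since \<open>k\<close> will be algebraically
  closed, the closed points of the projective line are the elements of \<open>k\<close> and the point at infinity.
\<close>

datatype 'k P1_point = Affine 'k | Infinity

definition const_fun :: "'k :: field \<Rightarrow> 'k poly fract" where
  "const_fun c = to_fract [:c:]"

text \<open>Order of vanishing at a point; the value at the zero function is irrelevant.\<close>

fun point_ord :: "'k :: field P1_point \<Rightarrow> 'k poly \<Rightarrow> int" where
  "point_ord (Affine a) p = int (order a p)"
| "point_ord Infinity p = - int (degree p)"

lemma point_ord_mult:
  "p \<noteq> 0 \<Longrightarrow> q \<noteq> 0 \<Longrightarrow> point_ord s (p * q) = point_ord s p + point_ord s q"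
  by (cases s) (auto simp: order_mult degree_mult_eq)

definition point_val :: "'k :: field P1_point \<Rightarrow> 'k poly fract \<Rightarrow> int" where
  "point_val s f = (if f = 0 then 0 else
     (THE n. \<exists>p q. p \<noteq> 0 \<and> q \<noteq> 0 \<and> f = Fract p q \<and> n = point_ord s p - point_ord s q))"

lemma point_val_Fract:
  assumes "p \<noteq> 0" "q \<noteq> 0"
  shows "point_val s (Fract p q) = point_ord s p - point_ord s q"
proof -
  have "point_ord s p' - point_ord s q' = point_ord s p - point_ord s q"
    if "p' \<noteq> 0" "q' \<noteq> 0" "Fract p q = Fract p' q'" for p' q'
  proof -
    from that assms have "p * q' = p' * q"
      by (simp add: eq_fract)
    then show ?thesis
      using point_ord_mult[of p q' s] point_ord_mult[of p' q s] that assms by simp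
  qed
  then have "(THE n. \<exists>p' q'. p' \<noteq> 0 \<and> q' \<noteq> 0 \<and> Fract p q = Fract p' q' \<and>
               n = point_ord s p' - point_ord s q') = point_ord s p - point_ord s q"
    using assms by (intro the_equality) blast+
  moreover have "Fract p q \<noteq> 0"
    using assms by (simp add: Zero_fract_def eq_fract)
  ultimately show ?thesis
    by (simp add: point_val_def)
qed

text \<open>The rational functions that are regular at the given point.\<close>

fun local_ring :: "'k :: field P1_point \<Rightarrow> 'k poly fract set" where
  "local_ring (Affine a) = {Fract p q | p q. poly q a \<noteq> 0}"
| "local_ring Infinity = {Fract p q | p q. q \<noteq> 0 \<and> degree p \<le> degree q}"

lemma local_ring_iff:
  fixes f :: "'k :: field poly fract"
  shows "f \<in> local_ring s \<longleftrightarrow> f = 0 \<or> point_val s f \<ge> 0"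
proof (cases "f = 0")
  case True
  have "\<exists>p q. (0 :: 'k poly fract) = Fract p q \<and> poly q a \<noteq> 0" for a
    by (rule exI[of _ 0], rule exI[of _ 1]) (simp add: Zero_fract_def)
  moreover have "\<exists>p q. (0 :: 'k poly fract) = Fract p q \<and> q \<noteq> 0 \<and> degree p \<le> degree q"
    by (rule exI[of _ 0], rule exI[of _ 1]) (simp add: Zero_fract_def)
  ultimately have "(0 :: 'k poly fract) \<in> local_ring s"
    by (cases s) simp_all
  with True show ?thesis by simp
next
  case False
  show ?thesis
  proof (cases s)
    case Infinity
    obtain p q where f: "f = Fract p q" "q \<noteq> 0" by (cases f)
    with False have p: "p \<noteq> 0" by (auto simp: Zero_fract_def eq_fract)
    have "point_val s f \<ge> 0" if reg: "f \<in> local_ring s"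
    proof -
      obtain p' q' where g: "f = Fract p' q'" "q' \<noteq> 0" "degree p' \<le> degree q'"
        using reg Infinity by auto
      with False have "p' \<noteq> 0" by (auto simp: Zero_fract_def eq_fract)
      with g Infinity show ?thesis by (simp add: point_val_Fract)
    qed
    moreover have "f \<in> local_ring s" if "point_val s f \<ge> 0"
      using that f p Infinity by (auto simp: point_val_Fract)
    ultimately show ?thesis using False by auto
  next
    case (Affine a)
    obtain p q where f: "f = Fract p q" "q \<noteq> 0" by (cases f)
    with False have p: "p \<noteq> 0" by (auto simp: Zero_fract_def eq_fract)
    have "point_val s f \<ge> 0" if reg: "f \<in> local_ring s"
    proof -
      obtain p' q' where g: "f = Fract p' q'" "poly q' a \<noteq> 0"
        using reg Affine by auto
      then have "q' \<noteq> 0" by auto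
      from g False have "p' \<noteq> 0" by (auto simp: Zero_fract_def eq_fract)
      with g \<open>q' \<noteq> 0\<close> Affine show ?thesis
        by (simp add: point_val_Fract order_0I)
    qed
    moreover have "f \<in> local_ring s" if v: "point_val s f \<ge> 0"
    proof -
      define n where "n = order a q"
      have le: "n \<le> order a p"
        using v f p Affine by (simp add: point_val_Fract n_def)
      obtain q1 where q1: "q = [:-a, 1:] ^ n * q1" "\<not> [:-a, 1:] dvd q1"
        using order_decomp[OF f(2)] unfolding n_def by blast
      have "[:-a, 1:] ^ n dvd p"
        using le by (simp add: order_divides)
      then obtain p1 where p1: "p = [:-a, 1:] ^ n * p1"
        by (rule dvdE)
      have nz: "q1 \<noteq> 0" "poly q1 a \<noteq> 0"
        using q1(2) by (auto simp: poly_eq_0_iff_dvd)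
      have "p * q1 = p1 * q"
        unfolding p1 q1(1) by (simp only: mult_ac)
      then have "f = Fract p1 q1"
        using f nz by (simp add: eq_fract)
      with nz Affine show ?thesis by auto
    qed
    ultimately show ?thesis using False by auto
  qed
qed


section \<open>Reduction of elliptic curves over the rational function field\<close>

definition integral_at :: "'k :: field P1_point \<Rightarrow> 'k poly fract weierstrass \<Rightarrow> bool" where
  "integral_at s W \<longleftrightarrow> set_weierstrass W \<subseteq> local_ring s"

definition minimal_equation_at ::
    "'k :: field P1_point \<Rightarrow> 'k poly fract weierstrass \<Rightarrow> 'k poly fract weierstrass \<Rightarrow> bool" where
  "minimal_equation_at s E W \<longleftrightarrow>
     weierstrass_equation_of E W \<and> integral_at s W \<and>
     (\<forall>W'. weierstrass_equation_of E W' \<and> integral_at s W' \<longrightarrow>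
        point_val s (disc W) \<le> point_val s (disc W'))"

definition good_reduction :: "'k :: field poly fract weierstrass \<Rightarrow> 'k P1_point \<Rightarrow> bool" where
  "good_reduction E s \<longleftrightarrow> (\<exists>W. minimal_equation_at s E W \<and> point_val s (disc W) = 0)"

definition bad_points :: "'k :: field poly fract weierstrass \<Rightarrow> 'k P1_point set" where
  "bad_points E = {s. \<not> good_reduction E s}"

definition constant_curve :: "'k :: field poly fract weierstrass \<Rightarrow> bool" where
  "constant_curve E \<longleftrightarrow> (\<exists>W. weierstrass_equation_of E W \<and> set_weierstrass W \<subseteq> range const_fun)"

definition constant_j :: "'k :: field poly fract weierstrass \<Rightarrow> bool" where
  "constant_j E \<longleftrightarrow> j_invariant E \<in> range const_fun"

end

theory Submission
  imports Defs "HOL-Number_Theory.Cong"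
begin

text \<open>
  Since \<open>k[T]\<close> is a principal ideal domain and 2 and 3 are invertible, \<open>E\<close> has an equation
  \<open>y\<^sup>2 = x\<^sup>3 + A x + B\<close> with polynomials \<open>A\<close> and \<open>B\<close> that is minimal at every affine point
  (\<open>minimal_polynomial_equation_exists\<close>). The roots of \<open>D = 4 A\<^sup>3 + 27 B\<^sup>2\<close> are then bad points, and
  good reduction at infinity implies that \<open>deg D = 12 d\<close>, \<open>deg A \<le> 4 d\<close> and \<open>deg B \<le> 6 d\<close> for some \<open>d\<close>
  (\<open>good_reduction_divisibility\<close>).

  If there are at most two bad points, one of them may be moved to infinity, so that \<open>D\<close> is a multiple
  of a power of \<open>T - a\<close>. The equation \<open>4 A\<^sup>3 + 27 B\<^sup>2 = c (T - a) ^ m\<close> is then so restrictive that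
  \<open>A\<close> and \<open>B\<close> are themselves multiples of powers of \<open>T - a\<close>, with exponents \<open>m / 3\<close> and \<open>m / 2\<close> unless
  they vanish. This is the content of \<open>constant_if_weighted_sum_is_monomial\<close>, which differentiates
  the equation in the manner of the Mason--Stothers theorem and, when all derivatives vanish in
  characteristic \<open>p\<close>, replaces \<open>T ^ p\<close> by \<open>T\<close>. Consequently \<open>A\<^sup>3\<close> is a constant multiple of \<open>D\<close>,
  that is, \<open>j(E)\<close> is constant. With at most one bad point, \<open>m\<close> is moreover a multiple of 12 and
  scaling the equation by a power of \<open>T - a\<close> makes \<open>A\<close> and \<open>B\<close> constant.

  Sharpness is witnessed by the Legendre curve and by \<open>y\<^sup>2 = x\<^sup>3 + T\<close>. Their bad points are found by
  observing that a change of coordinates alters the valuation of the discriminant by a multiple of 12.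
\<close>

section \<open>Weighted sums of a cube and a square equal to a monomial\<close>

text \<open>
  Over an algebraically closed field coprimality is the absence of a common root, so the roots of
  \<open>h\<close> can be cancelled from \<open>b\<close> one at a time.
\<close>

lemma dvd_right_factor_if_no_common_root:
  fixes h a b :: "'k::alg_closed_field poly"
  assumes "h \<noteq> 0" "h dvd a * b" "\<And>x. poly h x = 0 \<Longrightarrow> poly a x \<noteq> 0"
  shows "h dvd b"
  using assms
proof (induction "degree h" arbitrary: h b rule: less_induct)
  case less
  show ?case
  proof (cases "degree h = 0")
    case True
    with less.prems(1) show ?thesis by (simp add: is_unit_iff_degree unit_imp_dvd)
  next
    case False
    then obtain x where x: "poly h x = 0" using alg_closed_imp_poly_has_root[of h] by auto
    then obtain h' where h': "h = [:-x, 1:] * h'" by (auto simp: poly_eq_0_iff_dvd elim: dvdE)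
    have "[:-x, 1:] dvd a * b" using x less.prems(2) dvd_trans by (auto simp: poly_eq_0_iff_dvd)
    then have "poly (a * b) x = 0" by (subst poly_eq_0_iff_dvd)
    then have "poly b x = 0" using less.prems(3)[OF x] by simp
    then obtain b' where b': "b = [:-x, 1:] * b'" by (auto simp: poly_eq_0_iff_dvd elim: dvdE)
    have "h' \<noteq> 0" using h' less.prems(1) by auto
    have "[:-x, 1:] * h' dvd [:-x, 1:] * (a * b')"
      using less.prems(2) unfolding h' b' by (simp only: mult_ac)
    then have "h' dvd a * b'" by (subst (asm) dvd_mult_cancel_left) simp
    moreover have "degree h' < degree h" using \<open>h' \<noteq> 0\<close> by (simp add: h' degree_mult_eq del: mult_pCons_left)
    ultimately have "h' dvd b'"
      using less.hyps[of h' b'] \<open>h' \<noteq> 0\<close> less.prems(3) h' by auto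
    then show ?thesis unfolding h' b' by (rule mult_dvd_mono[OF dvd_refl])
  qed
qed

text \<open>
  The derivation \<open>T d/dT\<close>. Unlike \<open>d/dT\<close> it has the monomials as eigenvectors, so that an equation
  with a monomial on one side can be differentiated and that side eliminated.
\<close>

definition euler :: "'k::field poly \<Rightarrow> 'k poly" where
  "euler p = [:0, 1:] * pderiv p"

lemma euler_add: "euler (p + q) = euler p + euler q"
  by (simp add: euler_def pderiv_add algebra_simps)

lemma euler_mult: "euler (p * q) = p * euler q + q * euler p"
  by (simp add: euler_def pderiv_mult algebra_simps)

lemma euler_monom: "euler (monom c n) = of_nat n * monom c n"
  unfolding of_nat_mult_conv_smult smult_monom
  by (cases n) (auto simp: euler_def pderiv_monom simp flip: monom_Suc)

lemma degree_euler_le: "degree (euler p) \<le> degree p"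
  by (rule degree_le) (auto simp: euler_def coeff_pCons coeff_pderiv coeff_eq_0 split: nat.splits)

lemma euler_eq_0_iff: "euler p = 0 \<longleftrightarrow> pderiv p = 0"
  by (simp add: euler_def)

lemma coeff_pcompose_monom:
  fixes F :: "'k::comm_ring_1 poly"
  assumes "p > 0"
  shows "coeff (pcompose F (monom 1 p)) n = (if p dvd n then coeff F (n div p) else 0)"
proof (induction F arbitrary: n)
  case (pCons a F)
  have "coeff (pcompose (pCons a F) (monom 1 p)) n =
      (if n = 0 then a else 0) + (if n < p then 0 else if p dvd n - p then coeff F ((n - p) div p) else 0)"
    by (simp add: pcompose_pCons coeff_monom_mult pCons.IH coeff_pCons split: nat.splits)
  also have "\<dots> = (if p dvd n then coeff (pCons a F) (n div p) else 0)"
  proof (cases "n < p")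
    case True
    then show ?thesis by (auto dest: dvd_imp_le)
  next
    case False
    then obtain m where m: "n = p + m" using le_Suc_ex not_le by blast
    have "(p + m) div p = Suc (m div p)" using assms by simp
    then show ?thesis using assms by (simp add: m)
  qed
  finally show ?case .
qed simp

text \<open>
  In positive characteristic \<open>p\<close> a vanishing derivative leaves only the coefficients whose index is
  a multiple of \<open>p\<close>.
\<close>

lemma pderiv_eq_0_imp_pcompose_monom_CHAR:
  fixes f :: "'k::field poly"
  assumes "pderiv f = 0" "CHAR('k) > 0"
  obtains F where "f = pcompose F (monom 1 CHAR('k))"
proof -
  define p where "p = CHAR('k)"
  have p: "p > 0" using assms by (simp add: p_def)
  define F where "F = Poly (map (\<lambda>n. coeff f (p * n)) [0..<Suc (degree f)])"
  have F: "coeff F n = coeff f (p * n)" for n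
  proof (cases "n \<le> degree f")
    case True then show ?thesis by (simp add: F_def nth_default_def del: upt_Suc)
  next
    case False
    then have "p * n > degree f" using p by (metis less_le_trans mult_le_mono1 nat_mult_1 not_le Suc_leI One_nat_def)
    then show ?thesis using False by (simp add: F_def nth_default_def coeff_eq_0 del: upt_Suc)
  qed
  have z: "coeff f n = 0" if "\<not> p dvd n" for n
  proof -
    have "n \<noteq> 0" using that by (metis dvd_0_right)
    then obtain m where m: "n = Suc m" by (cases n) auto
    have "of_nat n * coeff f n = 0"
      using arg_cong[OF assms(1), of "\<lambda>q. coeff q m"] m by (simp add: coeff_pderiv)
    then show ?thesis using that by (simp add: of_nat_eq_0_iff_char_dvd p_def)
  qed
  have "f = pcompose F (monom 1 p)"
  proof (rule poly_eqI)
    fix n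
    show "coeff f n = coeff (pcompose F (monom 1 p)) n"
      using F z p by (simp add: coeff_pcompose_monom)
  qed
  then show thesis using that by (simp add: p_def)
qed

lemma monom_eq_sum_imp_exponents_eq:
  assumes "monom u i + monom v j = monom c m" "u \<noteq> 0" "v \<noteq> 0" "c \<noteq> (0::'k::field)"
  shows "i = j" "i = m"
proof -
  have c: "(if i = n then u else 0) + (if j = n then v else 0) = (if m = n then c else 0)" for n
    using arg_cong[OF assms(1), of "\<lambda>q. coeff q n"] by simp
  show "i = j" using c[of i] c[of j] assms by (auto split: if_splits)
  then show "i = m" using c[of m] assms by (auto split: if_splits)
qed

text \<open>
  The heart of the proof, a variant of the Mason--Stothers argument. With \<open>X = u T ^ i\<close>,
  \<open>Y = v T ^ j\<close> and \<open>\<theta> = T d/dT\<close>, differentiating the equation gives \<open>X f\<^sup>2 P = - Y g Q\<close>, where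
  \<open>P = (i - m) f + 3 \<theta> f\<close> has degree at most \<open>deg f\<close> and \<open>Q = (j - m) g + 2 \<theta> g\<close> has degree at most
  \<open>deg g\<close>. A common root of \<open>f\<close> and \<open>g\<close> would be a root of \<open>c T ^ m\<close>, hence 0, where neither
  vanishes; so \<open>f\<close>, \<open>g\<close> and \<open>T\<close> are pairwise coprime, \<open>f\<^sup>2\<close> divides \<open>Q\<close> and \<open>g\<close> divides \<open>P\<close>. If these are non-zero, \<open>2 deg f \<le> deg g \<le> deg f\<close> and both degrees are 0. Otherwise
  both derivatives vanish; either \<open>f\<close> and \<open>g\<close> are constant, or the characteristic is \<open>p > 0\<close>, the
  equation is one in \<open>T ^ p\<close>, and replacing \<open>T ^ p\<close> by \<open>T\<close> lowers the degrees.
\<close>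

lemma constant_if_weighted_sum_is_monomial:
  fixes f g :: "'k::alg_closed_field poly"
  assumes two: "(2::'k) \<noteq> 0" and three: "(3::'k) \<noteq> 0"
    and nz: "u \<noteq> 0" "v \<noteq> 0" "c \<noteq> 0"
    and "poly f 0 \<noteq> 0" "poly g 0 \<noteq> 0"
    and "monom u i * f ^ 3 + monom v j * g ^ 2 = monom c m"
  shows "degree f = 0 \<and> degree g = 0 \<and> i = m \<and> j = m"
  using assms(6-8)
proof (induction "degree f + degree g" arbitrary: f g i j m rule: less_induct)
  case less
  note f0 = less.prems(1) and g0 = less.prems(2) and eq = less.prems(3)
  have fnz: "f \<noteq> 0" and gnz: "g \<noteq> 0" using f0 g0 by auto
  have coprime: "poly (monom u i * f) x \<noteq> 0 \<or> poly (monom v j * g) x \<noteq> 0"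
    if "poly f x = 0 \<or> poly g x = 0" for x
  proof (rule ccontr)
    assume "\<not> ?thesis"
    then have "poly (monom u i * f ^ 3 + monom v j * g ^ 2) x = 0"
      by (auto simp: power2_eq_square power3_eq_cube)
    moreover have "x \<noteq> 0" using that f0 g0 by auto
    ultimately show False using nz unfolding eq by (simp add: poly_monom)
  qed
  \<comment> \<open>Apply \<open>euler\<close> to the equation and subtract \<open>m\<close> times the equation: the right-hand side cancels.\<close>
  define P where "P = (of_nat i - of_nat m) * f + 3 * euler f"
  define Q where "Q = (of_nat j - of_nat m) * g + 2 * euler g"
  define X where "X = monom u i"
  define Y where "Y = monom v j"
  have nzXY: "X \<noteq> 0" "Y \<noteq> 0" using nz by (auto simp: X_def Y_def)
  have "euler (X * f ^ 3 + Y * g ^ 2) = of_nat m * (X * f ^ 3 + Y * g ^ 2)"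
    unfolding X_def Y_def eq by (rule euler_monom)
  moreover have "euler X = of_nat i * X" "euler Y = of_nat j * Y"
    unfolding X_def Y_def by (rule euler_monom)+
  ultimately have key: "X * f ^ 2 * P = - (Y * g * Q)"
    unfolding P_def Q_def by (simp add: euler_add euler_mult power2_eq_square power3_eq_cube algebra_simps)
  have "f ^ 2 dvd Q"
  proof (rule dvd_right_factor_if_no_common_root)
    have "Y * g * Q = f ^ 2 * - (X * P)" using key by (simp add: algebra_simps)
    then show "f ^ 2 dvd (Y * g) * Q" by (rule dvdI)
    show "poly (Y * g) x \<noteq> 0" if "poly (f ^ 2) x = 0" for x
      using that coprime[of x] by (auto simp: Y_def)
  qed (use fnz in auto)
  have "g dvd P"
  proof (rule dvd_right_factor_if_no_common_root)
    show "g dvd (X * f ^ 2) * P" unfolding key by simp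
    show "poly (X * f ^ 2) x \<noteq> 0" if "poly g x = 0" for x
      using that coprime[of x] by (auto simp: X_def)
  qed (use gnz in auto)
  have degs: "degree P \<le> degree f" "degree Q \<le> degree g"
    unfolding P_def Q_def
    by (intro degree_add_le; simp add: of_nat_mult_conv_smult numeral_mult_conv_smult left_diff_distrib
        degree_diff_le degree_smult_le degree_euler_le order_trans[OF degree_smult_le] del: of_nat_diff)+
  have const: "i = m \<and> j = m" if deg: "degree f = 0" "degree g = 0"
  proof -
    obtain a where a: "f = [:a:]" using deg(1) by (rule degree_eq_zeroE)
    obtain b where b: "g = [:b:]" using deg(2) by (rule degree_eq_zeroE)
    have "monom u i * [:a:] ^ 3 = monom (u * a ^ 3) i" "monom v j * [:b:] ^ 2 = monom (v * b ^ 2) j"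
      by (simp_all add: poly_const_pow smult_monom mult.commute)
    then have "monom (u * a ^ 3) i + monom (v * b ^ 2) j = monom c m"
      using eq unfolding a b by simp
    moreover have "u * a ^ 3 \<noteq> 0" "v * b ^ 2 \<noteq> 0" using nz fnz gnz a b by auto
    ultimately have "i = j" "i = m" using nz(3) by (rule monom_eq_sum_imp_exponents_eq)+
    then show ?thesis by simp
  qed
  show ?case
  proof (cases "P = 0")
    case False
    then have "Q \<noteq> 0" using key nzXY fnz by auto
    then have "degree (f ^ 2) \<le> degree g" using \<open>f ^ 2 dvd Q\<close> degs dvd_imp_degree_le order_trans by blast
    moreover have "degree g \<le> degree f" using False \<open>g dvd P\<close> degs dvd_imp_degree_le order_trans by blast
    ultimately have "degree f = 0" "degree g = 0" using fnz by (auto simp: degree_power_eq)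
    with const show ?thesis by auto
  next
    case True
    then have "Q = 0" using key nzXY gnz by auto
    \<comment> \<open>\<open>euler f\<close> vanishes at 0 while \<open>f\<close> does not, so both summands of \<open>P\<close> vanish separately.\<close>
    have "poly P 0 = 0" "poly Q 0 = 0" using True \<open>Q = 0\<close> by auto
    then have im: "of_nat i = (of_nat m :: 'k)" and jm: "of_nat j = (of_nat m :: 'k)"
      using f0 g0 by (auto simp: P_def Q_def euler_def of_nat_poly)
    then have "of_nat i = (of_nat m :: 'k poly)" "of_nat j = (of_nat m :: 'k poly)"
      by (simp_all add: of_nat_poly)
    moreover have "(2::'k poly) \<noteq> 0" "(3::'k poly) \<noteq> 0" using two three by (simp_all add: numeral_poly)
    ultimately have d: "pderiv f = 0" "pderiv g = 0" using True \<open>Q = 0\<close>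
      by (auto simp: P_def Q_def simp flip: euler_eq_0_iff)
    show ?thesis
    proof (cases "degree f = 0 \<and> degree g = 0")
      case True with const show ?thesis by auto
    next
      case False
      define p where "p = CHAR('k)"
      have "p > 0"
      proof -
        have "\<exists>h::'k poly. pderiv h = 0 \<and> degree h > 0" using d False by auto
        then obtain h :: "'k poly" where h: "pderiv h = 0" "degree h > 0" by blast
        then have "of_nat (degree h) * lead_coeff h = 0"
          using coeff_pderiv[of h "degree h - 1"] by simp
        with h have "of_nat (degree h) = (0::'k)" by auto
        then show ?thesis using h(2) unfolding p_def CHAR_pos_iff by blast
      qed
      obtain F G where FG: "f = pcompose F (monom 1 p)" "g = pcompose G (monom 1 p)"
        using pderiv_eq_0_imp_pcompose_monom_CHAR[OF d(1)] pderiv_eq_0_imp_pcompose_monom_CHAR[OF d(2)] \<open>p > 0\<close>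
        unfolding p_def by metis
      have "p \<noteq> 1" by (simp add: p_def)
      then have "p > 1" using \<open>p > 0\<close> by auto
      \<comment> \<open>Modulo \<open>p\<close> the exponents agree, so after division by \<open>T ^ l\<close> they are multiples of \<open>p\<close>
        and the whole equation is one between polynomials in \<open>T ^ p\<close>.\<close>
      define l where "l = min i j"
      have "l \<le> m"
      proof (rule ccontr)
        assume "\<not> l \<le> m"
        then have "m < i" "m < j" by (auto simp: l_def)
        then have "coeff (monom u i * f ^ 3 + monom v j * g ^ 2) m = 0"
          by (simp add: coeff_monom_mult)
        then show False using nz unfolding eq by simp
      qed
      have "[i = m] (mod p)" "[j = m] (mod p)"
        using im jm by (simp_all add: of_nat_eq_iff_cong_CHAR p_def)
      then have cl: "[i = l] (mod p)" "[j = l] (mod p)" "[m = l] (mod p)"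
        by (auto simp: l_def min_def cong_def)
      have step: "\<exists>k. n = l + p * k" if "[n = l] (mod p)" "l \<le> n" for n
      proof -
        have "p dvd n - l" using that by (simp add: cong_altdef_nat)
        then obtain k where "n - l = p * k" by (rule dvdE)
        with that show ?thesis by (intro exI[of _ k]) simp
      qed
      have "l \<le> i" "l \<le> j" by (simp_all add: l_def)
      then obtain i' j' m' where ijm: "i = l + p * i'" "j = l + p * j'" "m = l + p * m'"
        using step[OF cl(1)] step[OF cl(2)] step[OF cl(3) \<open>l \<le> m\<close>] by blast
      have mon: "monom a (l + p * k) = monom 1 l * pcompose (monom a k) (monom 1 p)" for a :: 'k and k
      proof -
        have "pcompose (monom a k) (monom 1 p) = monom a (p * k)"
          using \<open>p > 0\<close> by (intro poly_eqI) (auto simp: coeff_pcompose_monom dest: dvdI[OF sym])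
        then show ?thesis by (simp add: mult_monom)
      qed
      have "monom 1 l * pcompose (monom u i' * F ^ 3 + monom v j' * G ^ 2 - monom c m') (monom 1 p) = 0"
        using eq unfolding ijm FG mon
        by (simp add: pcompose_add pcompose_diff pcompose_mult power2_eq_square power3_eq_cube algebra_simps)
      then have "pcompose (monom u i' * F ^ 3 + monom v j' * G ^ 2 - monom c m') (monom 1 p) = 0"
        by simp
      then have eq': "monom u i' * F ^ 3 + monom v j' * G ^ 2 = monom c m'"
        using \<open>p > 0\<close> by (subst (asm) pcompose_eq_0_iff) (auto simp: degree_monom_eq)
      have "degree f = p * degree F" "degree g = p * degree G"
        by (simp_all add: FG degree_pcompose degree_monom_eq)
      moreover from this have "degree F + degree G < p * (degree F + degree G)" using False \<open>p > 1\<close> by auto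
      ultimately have "degree F + degree G < degree f + degree g" by (simp add: algebra_simps)
      moreover have "poly F 0 \<noteq> 0" "poly G 0 \<noteq> 0"
        using f0 g0 \<open>p > 0\<close> by (auto simp: FG poly_pcompose poly_monom power_0_left)
      ultimately have "degree F = 0 \<and> degree G = 0" using less.hyps eq' by blast
      then show ?thesis using False by (simp add: FG degree_pcompose)
    qed
  qed
qed

section \<open>Discriminants with at most two roots\<close>

lemma monom_factor_decomp:
  assumes "(q::'k::field poly) \<noteq> 0"
  obtains k h where "q = monom 1 k * h" "poly h 0 \<noteq> 0"
proof -
  obtain h where "q = [:-0, 1:] ^ order 0 q * h" "\<not> [:-0, 1:] dvd h"
    using order_decomp[OF assms, of 0] by blast
  then show thesis using that[of "order 0 q" h] by (simp add: monom_altdef poly_eq_0_iff_dvd)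
qed

lemma power_eq_monom_imp_monom:
  fixes q :: "'k::field poly"
  assumes "q ^ n = monom c m" "c \<noteq> 0" "n > 0"
  obtains x k where "q = monom x k" "n * k = m"
proof -
  have "q \<noteq> 0" using assms by (auto simp: power_0_left)
  then obtain k h where q: "q = monom 1 k * h" "poly h 0 \<noteq> 0" by (rule monom_factor_decomp)
  have h: "h \<noteq> 0" "poly (h ^ n) 0 \<noteq> 0" using q by auto
  have eq: "monom 1 (n * k) * h ^ n = monom c m"
    using assms(1) by (simp add: q power_mult_distrib monom_power mult.commute)
  have "n * k = order 0 (monom 1 (n * k) * h ^ n)"
    using h by (subst order_mult) (auto simp: order_0I)
  also have "\<dots> = m" using assms by (simp add: eq)
  finally have nk: "n * k = m" .
  have "n * k + n * degree h = degree (monom 1 (n * k) * h ^ n)"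
    using h by (subst degree_mult_eq) (auto simp: degree_monom_eq degree_power_eq)
  also have "\<dots> = m" using assms by (simp add: eq degree_monom_eq)
  finally have "degree h = 0" using nk assms by simp
  then obtain x where "h = [:x:]" by (rule degree_eq_zeroE)
  then have "q = monom x k" by (simp add: q smult_monom)
  with nk that show thesis by blast
qed

text \<open>
  This is \<open>constant_if_weighted_sum_is_monomial\<close>, with the powers of \<open>T\<close> in \<open>A\<close> and \<open>B\<close> split off and
  the degenerate cases \<open>A = 0\<close> and \<open>B = 0\<close> included.
\<close>

lemma weighted_homogeneous_if_monomial_discriminant_0:
  fixes A B :: "'k::alg_closed_field poly"
  assumes two: "(2::'k) \<noteq> 0" and three: "(3::'k) \<noteq> 0"
    and eq: "smult 4 (A ^ 3) + smult 27 (B ^ 2) = monom c m" and c: "c \<noteq> 0"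
  shows "\<exists>x i y j. A = monom x i \<and> B = monom y j \<and> (x \<noteq> 0 \<longrightarrow> 3 * i = m) \<and> (y \<noteq> 0 \<longrightarrow> 2 * j = m)"
proof -
  have n4: "(4::'k) \<noteq> 0" using two by (metis mult_eq_0_iff numeral_times_numeral semiring_norm(11,13))
  have "(27::'k) = 3 * (3 * 3)" by simp
  then have n27: "(27::'k) \<noteq> 0" using three by (metis mult_eq_0_iff)
  consider "A = 0" | "B = 0" | "A \<noteq> 0" "B \<noteq> 0" by blast
  then show ?thesis
  proof cases
    case 1
    have "smult (1/27) (smult 27 (B ^ 2)) = smult (1/27) (monom c m)" using eq 1 by simp
    then have "B ^ 2 = monom (c / 27) m" using n27 by (simp add: smult_monom)
    then obtain y j where "B = monom y j" "2 * j = m"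
      by (rule power_eq_monom_imp_monom) (use n27 c in auto)
    with 1 show ?thesis by (intro exI[of _ 0] exI[of _ y] exI[of _ j]) auto
  next
    case 2
    have "smult (1/4) (smult 4 (A ^ 3)) = smult (1/4) (monom c m)" using eq 2 by simp
    then have "A ^ 3 = monom (c / 4) m" using n4 by (simp add: smult_monom)
    then obtain x i where "A = monom x i" "3 * i = m"
      by (rule power_eq_monom_imp_monom) (use n4 c in auto)
    with 2 show ?thesis by (intro exI[of _ x] exI[of _ i] exI[of _ 0]) auto
  next
    case 3
    obtain i f where f: "A = monom 1 i * f" "poly f 0 \<noteq> 0" using 3(1) by (rule monom_factor_decomp)
    obtain j g where g: "B = monom 1 j * g" "poly g 0 \<noteq> 0" using 3(2) by (rule monom_factor_decomp)
    have "monom 4 (3 * i) * f ^ 3 + monom 27 (2 * j) * g ^ 2 = monom c m"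
    proof -
      have "monom 4 (3 * i) = smult (4::'k) (monom 1 i ^ 3)" "monom 27 (2 * j) = smult (27::'k) (monom 1 j ^ 2)"
        by (simp_all add: monom_power smult_monom mult.commute)
      then show ?thesis
        unfolding eq[symmetric] f(1) g(1) power_mult_distrib by simp
    qed
    from constant_if_weighted_sum_is_monomial[OF two three n4 n27 c f(2) g(2) this]
    have deg: "degree f = 0" "degree g = 0" and ij: "3 * i = m" "2 * j = m" by auto
    obtain x where "f = [:x:]" using deg(1) by (rule degree_eq_zeroE)
    moreover obtain y where "g = [:y:]" using deg(2) by (rule degree_eq_zeroE)
    ultimately show ?thesis using ij
      by (intro exI[of _ x] exI[of _ i] exI[of _ y] exI[of _ j]) (simp add: f g smult_monom)
  qed
qed

lemma weighted_homogeneous_if_discriminant_has_one_root: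
  fixes A B :: "'k::alg_closed_field poly"
  assumes two: "(2::'k) \<noteq> 0" and three: "(3::'k) \<noteq> 0"
    and eq: "smult 4 (A ^ 3) + smult 27 (B ^ 2) = smult c ([:-a, 1:] ^ m)" and c: "c \<noteq> 0"
  obtains x i y j where "A = smult x ([:-a, 1:] ^ i)" "B = smult y ([:-a, 1:] ^ j)"
    "x \<noteq> 0 \<Longrightarrow> 3 * i = m" "y \<noteq> 0 \<Longrightarrow> 2 * j = m"
proof -
  have shift: "pcompose [:-a, 1:] [:a, 1:] = [:0, 1:]" and unshift: "pcompose [:a, 1:] [:-a, 1:] = [:0, 1:]"
    by (simp_all add: pcompose_pCons)
  have pow: "pcompose (p ^ n) q = pcompose p q ^ n" for p q :: "'k poly" and n
    by (induction n) (simp_all add: pcompose_mult pcompose_1)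
  have "smult 4 (pcompose A [:a, 1:] ^ 3) + smult 27 (pcompose B [:a, 1:] ^ 2) = monom c m"
    using arg_cong[OF eq, of "\<lambda>p. pcompose p [:a, 1:]"]
    by (simp add: pcompose_add pcompose_smult pow shift monom_altdef)
  from weighted_homogeneous_if_monomial_discriminant_0[OF two three this c]
  obtain x i y j where *: "pcompose A [:a, 1:] = monom x i" "pcompose B [:a, 1:] = monom y j"
      "x \<noteq> 0 \<longrightarrow> 3 * i = m" "y \<noteq> 0 \<longrightarrow> 2 * j = m" by blast
  have unshifted: "p = smult z ([:-a, 1:] ^ k)" if "pcompose p [:a, 1:] = monom z k" for p z k
    using arg_cong[OF that, of "\<lambda>p. pcompose p [:-a, 1:]"]
    by (simp add: unshift pcompose_assoc[symmetric] monom_altdef pcompose_smult pow pcompose_pCons)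
  show thesis using that * unshifted by blast
qed

lemma infinite_UNIV_alg_closed_field: "infinite (UNIV :: 'k::alg_closed_field set)"
proof
  assume fin: "finite (UNIV :: 'k set)"
  define p where "p = (\<Prod>a\<in>(UNIV::'k set). [:-a, 1:])"
  have "degree p = card (UNIV :: 'k set)"
    unfolding p_def by (subst degree_prod_eq_sum_degree) auto
  then have "degree (p + 1) > 0"
    using fin by (subst degree_add_eq_left) (auto simp: card_gt_0_iff)
  then obtain x where "poly (p + 1) x = 0" using alg_closed_imp_poly_has_root by blast
  moreover have "poly p x = 0" using fin by (simp add: p_def poly_prod)
  ultimately show False by simp
qed

lemma poly_eqI_except_at:
  fixes p q :: "'k::alg_closed_field poly"
  assumes "\<And>x. x \<noteq> z \<Longrightarrow> poly p x = poly q x"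
  shows "p = q"
proof (rule ccontr)
  assume "p \<noteq> q"
  then have "finite {x. poly (p - q) x = 0}" by (intro poly_roots_finite) simp
  moreover have "UNIV - {z} \<subseteq> {x. poly (p - q) x = 0}" using assms by auto
  ultimately show False
    using infinite_UNIV_alg_closed_field[where 'k = 'k] by (meson finite_subset finite_Diff2 finite.emptyI finite_insert)
qed

text \<open>
  The polynomial side of the coordinate change that moves the point \<open>a\<close> to infinity and infinity to
  0: \<open>p\<close> is homogenised as a form of degree \<open>N\<close> and dehomogenised at the other end.
\<close>

lemma ex_poly_inverted_at:
  fixes p :: "'k::field poly"
  assumes "degree p \<le> N"
  obtains q where "\<And>x. x \<noteq> 0 \<Longrightarrow> poly q x = x ^ N * poly p (a + 1 / x)"
proof -
  define r where "r = pcompose p [:a, 1:]"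
  have deg: "degree r \<le> N" using assms by (simp add: r_def degree_pcompose)
  have "poly (monom 1 (N - degree r) * reflect_poly r) x = x ^ N * poly p (a + 1 / x)" if "x \<noteq> 0" for x
  proof -
    have "x ^ (N - degree r) * x ^ degree r = x ^ N" using deg by (simp flip: power_add)
    then show ?thesis using that
      by (simp add: poly_monom poly_reflect_poly_nz r_def poly_pcompose inverse_eq_divide flip: mult.assoc)
  qed
  then show thesis using that by blast
qed

text \<open>
  The numerical conditions are those that good reduction at infinity imposes on \<open>A\<close> and \<open>B\<close>. They
  ensure that moving \<open>a\<close> to infinity leaves a discriminant whose only possible root is the image
  \<open>1 / (b - a)\<close> of \<open>b\<close>, and the case of one root applies. The conclusion, which says that the
  \<open>j\<close>-invariant is constant, is then transported back.
\<close>

lemma cube_proportional_to_discriminant_with_two_roots: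
  fixes A B :: "'k::alg_closed_field poly"
  assumes two: "(2::'k) \<noteq> 0" and three: "(3::'k) \<noteq> 0"
    and eq: "smult 4 (A ^ 3) + smult 27 (B ^ 2) = smult c ([:-a, 1:] ^ m * [:-b, 1:] ^ n)" and c: "c \<noteq> 0"
    and "a \<noteq> b" "m + n = 12 * d" "degree A \<le> 4 * d" "degree B \<le> 6 * d"
  shows "\<exists>x. A ^ 3 = smult x ([:-a, 1:] ^ m * [:-b, 1:] ^ n)"
proof -
  obtain A' where A': "\<And>x. x \<noteq> 0 \<Longrightarrow> poly A' x = x ^ (4 * d) * poly A (a + 1 / x)"
    using ex_poly_inverted_at[OF assms(7)] by blast
  obtain B' where B': "\<And>x. x \<noteq> 0 \<Longrightarrow> poly B' x = x ^ (6 * d) * poly B (a + 1 / x)"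
    using ex_poly_inverted_at[OF assms(8)] by blast
  define e where "e = 1 / (b - a)"
  have disc: "x ^ (12 * d) * poly ([:-a, 1:] ^ m * [:-b, 1:] ^ n) (a + 1 / x) = (a - b) ^ n * poly ([:-e, 1:] ^ n) x"
    if "x \<noteq> 0" for x
  proof -
    have "x ^ (12 * d) = x ^ m * x ^ n" by (simp add: assms(6)[symmetric] power_add)
    moreover have "poly ([:-a, 1:] ^ m * [:-b, 1:] ^ n) (a + 1 / x) = (1 / x) ^ m * (a + 1 / x - b) ^ n"
      by (simp add: algebra_simps)
    ultimately have "x ^ (12 * d) * poly ([:-a, 1:] ^ m * [:-b, 1:] ^ n) (a + 1 / x)
        = (x * (1 / x)) ^ m * (x * (a + 1 / x - b)) ^ n"
      by (simp only: power_mult_distrib mult_ac)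
    also have "x * (a + 1 / x - b) = (a - b) * (x - e)"
      using that assms(5) by (simp add: e_def field_simps)
    finally show ?thesis using that by (simp add: power_mult_distrib)
  qed
  have "smult 4 (A' ^ 3) + smult 27 (B' ^ 2) = smult (c * (a - b) ^ n) ([:-e, 1:] ^ n)"
  proof (rule poly_eqI_except_at)
    fix x :: 'k assume x: "x \<noteq> 0"
    have "poly (smult 4 (A' ^ 3) + smult 27 (B' ^ 2)) x =
       x ^ (12 * d) * poly (smult 4 (A ^ 3) + smult 27 (B ^ 2)) (a + 1 / x)"
      using x by (simp add: A' B' power_mult_distrib algebra_simps flip: power_mult)
    also have "\<dots> = c * (x ^ (12 * d) * poly ([:-a, 1:] ^ m * [:-b, 1:] ^ n) (a + 1 / x))"
      unfolding eq by simp
    also have "\<dots> = poly (smult (c * (a - b) ^ n) ([:-e, 1:] ^ n)) x"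
      unfolding disc[OF x] by simp
    finally show "poly (smult 4 (A' ^ 3) + smult 27 (B' ^ 2)) x = poly (smult (c * (a - b) ^ n) ([:-e, 1:] ^ n)) x" .
  qed
  then obtain z i where zi: "A' = smult z ([:-e, 1:] ^ i)" "z \<noteq> 0 \<Longrightarrow> 3 * i = n"
    using weighted_homogeneous_if_discriminant_has_one_root[OF two three] c \<open>a \<noteq> b\<close> by (metis mult_eq_0_iff power_eq_0_iff right_minus_eq)
  have A3: "A' ^ 3 = smult (z ^ 3) ([:-e, 1:] ^ n)"
    using zi by (cases "z = 0") (auto simp: smult_power mult.commute simp flip: power_mult)
  have "A ^ 3 = smult (z ^ 3 / (a - b) ^ n) ([:-a, 1:] ^ m * [:-b, 1:] ^ n)"
  proof (rule poly_eqI_except_at)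
    fix y assume y: "y \<noteq> a"
    define x where "x = 1 / (y - a)"
    have x: "x \<noteq> 0" "a + 1 / x = y" using y by (simp_all add: x_def)
    have "x ^ (12 * d) * poly (A ^ 3) y = poly (A' ^ 3) x"
      using x by (simp add: A' power_mult_distrib flip: power_mult)
    also have "\<dots> = z ^ 3 / (a - b) ^ n * ((a - b) ^ n * poly ([:-e, 1:] ^ n) x)"
      using \<open>a \<noteq> b\<close> unfolding A3 by simp
    also have "\<dots> = x ^ (12 * d) * poly (smult (z ^ 3 / (a - b) ^ n) ([:-a, 1:] ^ m * [:-b, 1:] ^ n)) y"
      unfolding disc[OF x(1), symmetric] x(2) by simp
    finally show "poly (A ^ 3) y = poly (smult (z ^ 3 / (a - b) ^ n) ([:-a, 1:] ^ m * [:-b, 1:] ^ n)) y"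
      using x(1) by (subst (asm) mult_left_cancel) auto
  qed
  then show ?thesis by blast
qed

lemma factorization_if_roots_in_pair:
  fixes p :: "'k::alg_closed_field poly"
  assumes "p \<noteq> 0" "\<And>x. poly p x = 0 \<Longrightarrow> x = a \<or> x = b"
  obtains c m n where "c \<noteq> 0" "p = smult c ([:-a, 1:] ^ m * [:-b, 1:] ^ n)" "a = b \<Longrightarrow> n = 0"
proof -
  obtain q where q: "p = [:-a, 1:] ^ order a p * q" "\<not> [:-a, 1:] dvd q"
    using order_decomp[OF assms(1)] by blast
  have "q \<noteq> 0" using q by auto
  then obtain r where r: "q = [:-b, 1:] ^ order b q * r" "\<not> [:-b, 1:] dvd r"
    using order_decomp by blast
  have "poly r x \<noteq> 0" for x
  proof
    assume x: "poly r x = 0"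
    then have "poly q x = 0" by (subst r) simp
    then have "poly p x = 0" by (subst q) simp
    with assms(2) x \<open>poly q x = 0\<close> q r show False by (auto simp: poly_eq_0_iff_dvd)
  qed
  then have "degree r = 0" using alg_closed_imp_poly_has_root by blast
  then obtain c where c: "r = [:c:]" by (rule degree_eq_zeroE)
  show thesis
  proof (rule that)
    show "c \<noteq> 0" using c r by auto
    show "p = smult c ([:-a, 1:] ^ order a p * [:-b, 1:] ^ order b q)"
    proof -
      have "p = [:-a, 1:] ^ order a p * ([:-b, 1:] ^ order b q * [:c:])"
        using q(1) r(1) c by simp
      then show ?thesis by (simp flip: mult.assoc)
    qed
    show "order b q = 0" if "a = b" using q that by (simp add: order_0I poly_eq_0_iff_dvd)
  qed
qed

section \<open>Invariants and changes of coordinates\<close>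

text \<open>
  The usual companion of \<open>wc4\<close>. It is an invariant of weight 6 that recovers the constant
  coefficient of a short equation outside characteristic 2 and 3.
\<close>

definition wc6 :: "'a :: comm_ring_1 weierstrass \<Rightarrow> 'a" where
  "wc6 W = - (wb2 W ^ 3) + 36 * wb2 W * wb4 W - 216 * wb6 W"

lemma four_wb8: "4 * wb8 W = wb2 W * wb6 W - wb4 W ^ 2"
  by (simp add: wb2_def wb4_def wb6_def wb8_def power2_eq_square algebra_simps)

context
  fixes u r s t :: "'a::field" and W V :: "'a weierstrass"
  assumes u: "u \<noteq> 0" and V: "V = change_coords u r s t W"
begin

lemma change_coords_coeffs:
    "u * wa1 V = wa1 W + 2 * s"
    "u ^ 2 * wa2 V = wa2 W - s * wa1 W + 3 * r - s ^ 2"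
    "u ^ 3 * wa3 V = wa3 W + r * wa1 W + 2 * t"
    "u ^ 4 * wa4 V = wa4 W - s * wa3 W + 2 * r * wa2 W - (t + r * s) * wa1 W + 3 * r ^ 2 - 2 * s * t"
    "u ^ 6 * wa6 V = wa6 W + r * wa4 W + r ^ 2 * wa2 W + r ^ 3 - t * wa3 W - t ^ 2 - r * t * wa1 W"
  using u by (simp_all add: V change_coords_def)

lemma change_coords_wb:
  "u ^ 2 * wb2 V = wb2 W + 12 * r"
  "u ^ 4 * wb4 V = wb4 W + r * wb2 W + 6 * r ^ 2"
  "u ^ 6 * wb6 V = wb6 W + 2 * r * wb4 W + r ^ 2 * wb2 W + 4 * r ^ 3"
  "u ^ 8 * wb8 V = wb8 W + 3 * r * wb6 W + 3 * r ^ 2 * wb4 W + r ^ 3 * wb2 W + 3 * r ^ 4"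
proof -
  have "u ^ 2 * wb2 V = (u * wa1 V) ^ 2 + 4 * (u ^ 2 * wa2 V)"
    unfolding wb2_def by algebra
  also have "\<dots> = wb2 W + 12 * r"
    unfolding wb2_def change_coords_coeffs by algebra
  finally show "u ^ 2 * wb2 V = wb2 W + 12 * r" .
  have "u ^ 4 * wb4 V = 2 * (u ^ 4 * wa4 V) + (u * wa1 V) * (u ^ 3 * wa3 V)"
    unfolding wb4_def by algebra
  also have "\<dots> = wb4 W + r * wb2 W + 6 * r ^ 2"
    unfolding wb2_def wb4_def change_coords_coeffs by algebra
  finally show "u ^ 4 * wb4 V = wb4 W + r * wb2 W + 6 * r ^ 2" .
  have "u ^ 6 * wb6 V = (u ^ 3 * wa3 V) ^ 2 + 4 * (u ^ 6 * wa6 V)"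
    unfolding wb6_def by algebra
  also have "\<dots> = wb6 W + 2 * r * wb4 W + r ^ 2 * wb2 W + 4 * r ^ 3"
    unfolding wb2_def wb4_def wb6_def change_coords_coeffs by algebra
  finally show "u ^ 6 * wb6 V = wb6 W + 2 * r * wb4 W + r ^ 2 * wb2 W + 4 * r ^ 3" .
  have "u ^ 8 * wb8 V = (u * wa1 V) ^ 2 * (u ^ 6 * wa6 V) + 4 * (u ^ 2 * wa2 V) * (u ^ 6 * wa6 V)
      - (u * wa1 V) * (u ^ 3 * wa3 V) * (u ^ 4 * wa4 V) + (u ^ 2 * wa2 V) * (u ^ 3 * wa3 V) ^ 2 - (u ^ 4 * wa4 V) ^ 2"
    unfolding wb8_def by algebra
  also have "\<dots> = wb8 W + 3 * r * wb6 W + 3 * r ^ 2 * wb4 W + r ^ 3 * wb2 W + 3 * r ^ 4"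
    unfolding wb2_def wb4_def wb6_def wb8_def change_coords_coeffs by algebra
  finally show "u ^ 8 * wb8 V = wb8 W + 3 * r * wb6 W + 3 * r ^ 2 * wb4 W + r ^ 3 * wb2 W + 3 * r ^ 4" .
qed

lemma change_coords_wc4: "u ^ 4 * wc4 V = wc4 W"
proof -
  have "u ^ 4 * wc4 V = (u ^ 2 * wb2 V) ^ 2 - 24 * (u ^ 4 * wb4 V)"
    unfolding wc4_def by algebra
  also have "\<dots> = wc4 W" unfolding change_coords_wb wc4_def by algebra
  finally show ?thesis .
qed

lemma change_coords_wc6: "u ^ 6 * wc6 V = wc6 W"
proof -
  have "u ^ 6 * wc6 V = - ((u ^ 2 * wb2 V) ^ 3) + 36 * (u ^ 2 * wb2 V) * (u ^ 4 * wb4 V) - 216 * (u ^ 6 * wb6 V)"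
    unfolding wc6_def by algebra
  also have "\<dots> = wc6 W" unfolding change_coords_wb wc6_def by algebra
  finally show ?thesis .
qed

lemma change_coords_disc: "u ^ 12 * disc V = disc W"
proof -
  have "u ^ 12 * disc V = - ((u ^ 2 * wb2 V) ^ 2) * (u ^ 8 * wb8 V) - 8 * (u ^ 4 * wb4 V) ^ 3
      - 27 * (u ^ 6 * wb6 V) ^ 2 + 9 * (u ^ 2 * wb2 V) * (u ^ 4 * wb4 V) * (u ^ 6 * wb6 V)"
    unfolding disc_def by algebra
  also have "\<dots> = disc W" unfolding change_coords_wb disc_def using four_wb8[of W] by algebra
  finally show ?thesis .
qed

end

lemma weierstrass_eqI:
  "wa1 V = wa1 W \<Longrightarrow> wa2 V = wa2 W \<Longrightarrow> wa3 V = wa3 W \<Longrightarrow> wa4 V = wa4 W \<Longrightarrow> wa6 V = wa6 W \<Longrightarrow> V = W"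
  by (rule weierstrass.expand) auto

lemma change_coords_compose:
  assumes "u \<noteq> 0" "u' \<noteq> (0::'a::field)"
  shows "change_coords u' r' s' t' (change_coords u r s t W) =
    change_coords (u * u') (u ^ 2 * r' + r) (u * s' + s) (u ^ 3 * t' + u ^ 2 * s * r' + t) W"
proof -
  define V where "V = change_coords u r s t W"
  define X where "X = change_coords u' r' s' t' V"
  define Y where "Y = change_coords (u * u') (u ^ 2 * r' + r) (u * s' + s) (u ^ 3 * t' + u ^ 2 * s * r' + t) W"
  note V = change_coords_coeffs[OF assms(1) V_def]
  note X = change_coords_coeffs[OF assms(2) X_def]
  have uu: "u * u' \<noteq> 0" using assms by simp
  note Y = change_coords_coeffs[OF uu Y_def]
  have "X = Y"
  proof (rule weierstrass_eqI)
    have "u * (u' * wa1 X) = u * u' * wa1 Y" unfolding X Y using V(1) by algebra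
    then show "wa1 X = wa1 Y" using uu by simp
    have "(u * u') ^ 2 * wa2 X = u ^ 2 * (u' ^ 2 * wa2 X)" by algebra
    also have "\<dots> = (u * u') ^ 2 * wa2 Y" unfolding X Y using V(1,2) by algebra
    finally show "wa2 X = wa2 Y" using uu by simp
    have "(u * u') ^ 3 * wa3 X = u ^ 3 * (u' ^ 3 * wa3 X)" by algebra
    also have "\<dots> = (u * u') ^ 3 * wa3 Y" unfolding X Y using V(1,3) by algebra
    finally show "wa3 X = wa3 Y" using uu by simp
    have "(u * u') ^ 4 * wa4 X = u ^ 4 * (u' ^ 4 * wa4 X)" by algebra
    also have "\<dots> = (u * u') ^ 4 * wa4 Y" unfolding X Y using V(1-4) by algebra
    finally show "wa4 X = wa4 Y" using uu by simp
    have "(u * u') ^ 6 * wa6 X = u ^ 6 * (u' ^ 6 * wa6 X)" by algebra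
    also have "\<dots> = (u * u') ^ 6 * wa6 Y" unfolding X Y using V by algebra
    finally show "wa6 X = wa6 Y" using uu by simp
  qed
  then show ?thesis by (simp add: X_def V_def Y_def)
qed

lemma change_coords_id: "change_coords 1 0 0 0 W = W"
  by (rule weierstrass_eqI) (simp_all add: change_coords_def)

lemma weierstrass_equation_of_refl: "weierstrass_equation_of E E"
  unfolding weierstrass_equation_of_def by (metis change_coords_id one_neq_zero)

lemma weierstrass_equation_of_trans:
  "weierstrass_equation_of E V \<Longrightarrow> weierstrass_equation_of V W \<Longrightarrow> weierstrass_equation_of E W"
  unfolding weierstrass_equation_of_def by (metis change_coords_compose no_zero_divisors)

lemma weierstrass_equation_of_sym:
  assumes "weierstrass_equation_of E W"
  shows "weierstrass_equation_of W E"
proof -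
  obtain u r s t where u: "u \<noteq> 0" "W = change_coords u r s t E"
    using assms unfolding weierstrass_equation_of_def by blast
  have "change_coords (1 / u) (- r / u ^ 2) (- s / u) ((r * s - t) / u ^ 3) W = change_coords 1 0 0 0 E"
    unfolding u(2) using u(1) by (subst change_coords_compose) (auto simp: field_simps)
  then show ?thesis using u(1) unfolding weierstrass_equation_of_def
    by (intro exI[of _ "1/u"] exI[of _ "- r / u ^ 2"] exI[of _ "- s / u"] exI[of _ "(r * s - t) / u ^ 3"])
      (simp add: change_coords_id)
qed

lemma weierstrass_equation_of_disc_nonzero:
  "weierstrass_equation_of E W \<Longrightarrow> disc E \<noteq> 0 \<Longrightarrow> disc W \<noteq> 0"
  unfolding weierstrass_equation_of_def using change_coords_disc by (metis mult_zero_right)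

lemma weierstrass_equation_of_j_invariant:
  assumes "weierstrass_equation_of E W"
  shows "j_invariant W = j_invariant E"
proof -
  obtain u r s t where u: "u \<noteq> 0" "W = change_coords u r s t E"
    using assms unfolding weierstrass_equation_of_def by blast
  have "j_invariant E = (u ^ 12 * wc4 W ^ 3) / (u ^ 12 * disc W)"
    unfolding j_invariant_def change_coords_disc[OF u, symmetric] change_coords_wc4[OF u, symmetric]
    by (simp add: power_mult_distrib flip: power_mult)
  then show ?thesis using u(1) by (simp add: j_invariant_def)
qed

definition short :: "'a::comm_ring_1 \<Rightarrow> 'a \<Rightarrow> 'a weierstrass" where
  "short A B = Weierstrass 0 0 0 A B"

lemma short_invariants:
  "wc4 (short A B) = - 48 * A" "wc6 (short A B) = - 864 * B"
  "disc (short A B) = - 16 * (4 * A ^ 3 + 27 * B ^ 2)"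
  by (simp_all add: short_def wc4_def wc6_def disc_def wb2_def wb4_def wb6_def wb8_def
      power2_eq_square power3_eq_cube algebra_simps)

lemma change_coords_short:
  "change_coords u 0 0 0 (short A B) = short (A / u ^ 4) (B / u ^ 6)"
  by (simp add: change_coords_def short_def)

text \<open>
  Completing the square in \<open>y\<close> and the cube in \<open>x\<close>.
\<close>

lemma short_equation_exists:
  fixes E :: "'a::field weierstrass"
  assumes "(2::'a) \<noteq> 0" "(3::'a) \<noteq> 0"
  obtains A B where "weierstrass_equation_of E (short A B)"
proof -
  have 4: "(4::'a) \<noteq> 0" "(12::'a) \<noteq> 0"
  proof -
    have "(4::'a) = 2 * 2" by simp then show "(4::'a) \<noteq> 0" using assms(1) by (metis mult_eq_0_iff)
    moreover have "(12::'a) = 4 * 3" by simp ultimately show "(12::'a) \<noteq> 0" using assms(2) by (metis mult_eq_0_iff)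
  qed
  define s where "s = - wa1 E / 2"
  define r where "r = - wb2 E / 12"
  define t where "t = - (wa3 E + r * wa1 E) / 2"
  define V where "V = change_coords 1 r s t E"
  have s: "2 * s = - wa1 E" and r: "12 * r = - wb2 E" and t: "2 * t = - (wa3 E + r * wa1 E)"
    using assms 4 by (simp_all add: s_def r_def t_def)
  have "4 * (wa2 E - s * wa1 E + 3 * r - s ^ 2) = 0"
    using s r unfolding wb2_def by algebra
  then have "wa2 E - s * wa1 E + 3 * r - s ^ 2 = 0" using 4 by (metis mult_eq_0_iff)
  then have "V = short (wa4 V) (wa6 V)" using 4 s t
    by (intro weierstrass_eqI) (simp_all add: V_def change_coords_def short_def)
  moreover have "weierstrass_equation_of E V"
    unfolding weierstrass_equation_of_def V_def using zero_neq_one by metis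
  ultimately show thesis using that by metis
qed

section \<open>Valuations, integrality and good reduction\<close>

lemma point_val_to_fract: "p \<noteq> 0 \<Longrightarrow> point_val s (to_fract p) = point_ord s p"
  unfolding to_fract_def by (subst point_val_Fract) (cases s; simp)+

lemma point_val_mult:
  assumes "f \<noteq> 0" "g \<noteq> 0"
  shows "point_val s (f * g) = point_val s f + point_val s g"
proof -
  obtain p q where f: "f = Fract p q" "q \<noteq> 0" by (cases f)
  obtain p' q' where g: "g = Fract p' q'" "q' \<noteq> 0" by (cases g)
  have "p \<noteq> 0" "p' \<noteq> 0" using assms f g by (auto simp: fract_collapse)
  then show ?thesis using f g by (simp add: point_val_Fract point_ord_mult)
qed

lemma point_val_one [simp]: "point_val s 1 = 0"
  using point_val_to_fract[of 1 s] by (cases s) simp_all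

lemma point_val_power: "f \<noteq> 0 \<Longrightarrow> point_val s (f ^ n) = int n * point_val s f"
  by (induction n) (simp_all add: point_val_mult algebra_simps)

lemma const_fun_eq_0_iff [simp]: "const_fun c = 0 \<longleftrightarrow> c = 0"
  by (simp add: const_fun_def)

lemma point_val_const_fun: "c \<noteq> 0 \<Longrightarrow> point_val s (const_fun c) = 0"
  by (cases s) (simp_all add: const_fun_def point_val_to_fract order_0I)

lemma to_fract_smult: "to_fract (smult c p) = const_fun c * to_fract p"
  by (simp add: const_fun_def flip: to_fract_mult)

lemma to_fract_power: "to_fract (p ^ n) = to_fract p ^ n"
  by (induction n) simp_all

lemma const_fun_numeral: "const_fun (numeral n) = numeral n"
proof -
  have "to_fract (of_nat m) = (of_nat m :: 'a poly fract)" for m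
    by (induction m) simp_all
  from this[of "numeral n"] show ?thesis by (simp add: const_fun_def numeral_poly)
qed

lemma const_fun_hom:
  "const_fun (a + b) = const_fun a + const_fun b"
  "const_fun (a * b) = const_fun a * const_fun b"
  "const_fun (- a) = - const_fun a"
  "const_fun (a - b) = const_fun a - const_fun b"
  "const_fun 1 = 1"
  by (simp_all add: const_fun_def flip: to_fract_add to_fract_mult to_fract_uminus to_fract_diff one_pCons)

lemma const_fun_power: "const_fun (a ^ n) = const_fun a ^ n"
  by (induction n) (simp_all add: const_fun_hom)

lemma local_ring_mult: "f \<in> local_ring s \<Longrightarrow> g \<in> local_ring s \<Longrightarrow> f * g \<in> local_ring s"
  by (cases "f = 0 \<or> g = 0") (auto simp: local_ring_iff point_val_mult)

lemma local_ring_uminus: "f \<in> local_ring s \<Longrightarrow> - f \<in> local_ring s"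
  by (cases s) (force simp: fract_collapse)+

lemma local_ring_const_fun: "const_fun c \<in> local_ring s"
  by (cases "c = 0") (auto simp: local_ring_iff point_val_const_fun)

lemma local_ring_add:
  assumes "f \<in> local_ring s" "g \<in> local_ring s"
  shows "f + g \<in> local_ring s"
proof (cases s)
  case (Affine a)
  then obtain p q p' q' where "f = Fract p q" "poly q a \<noteq> 0" "g = Fract p' q'" "poly q' a \<noteq> 0"
    using assms by auto
  moreover from this have "q \<noteq> 0" "q' \<noteq> 0" by auto
  ultimately have "f + g = Fract (p * q' + p' * q) (q * q')" "poly (q * q') a \<noteq> 0" by auto
  then show ?thesis unfolding Affine local_ring.simps by blast
next
  case Infinity
  then obtain p q p' q' where *: "f = Fract p q" "q \<noteq> 0" "degree p \<le> degree q"
      "g = Fract p' q'" "q' \<noteq> 0" "degree p' \<le> degree q'"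
    using assms by auto
  then have "f + g = Fract (p * q' + p' * q) (q * q')" by auto
  moreover have "degree (p * q' + p' * q) \<le> degree (q * q')"
    using * degree_mult_le[of p q'] degree_mult_le[of p' q]
    by (intro degree_add_le) (auto simp: degree_mult_eq)
  moreover have "q * q' \<noteq> 0" using * by simp
  ultimately show ?thesis unfolding Infinity local_ring.simps by blast
qed

lemma local_ring_diff: "f \<in> local_ring s \<Longrightarrow> g \<in> local_ring s \<Longrightarrow> f - g \<in> local_ring s"
  using local_ring_add[of f s "- g"] local_ring_uminus[of g s] by simp

lemma local_ring_power: "f \<in> local_ring s \<Longrightarrow> f ^ n \<in> local_ring s"
  using local_ring_const_fun[of 1 s] by (induction n) (auto simp: const_fun_hom local_ring_mult)

lemma local_ring_numeral: "numeral n \<in> local_ring s"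
  using local_ring_const_fun[of "numeral n" s] by (simp add: const_fun_numeral)

lemmas local_ring_intros = local_ring_add local_ring_diff local_ring_mult local_ring_uminus
  local_ring_power local_ring_numeral

lemma integral_at_invariants:
  assumes "integral_at s W"
  shows "wc4 W \<in> local_ring s" "wc6 W \<in> local_ring s" "disc W \<in> local_ring s"
proof -
  have [intro]: "wa1 W \<in> local_ring s" "wa2 W \<in> local_ring s" "wa3 W \<in> local_ring s" "wa4 W \<in> local_ring s"
    "wa6 W \<in> local_ring s"
    using assms by (auto simp: integral_at_def weierstrass.set_sel)
  show "wc4 W \<in> local_ring s" "wc6 W \<in> local_ring s" "disc W \<in> local_ring s"
    unfolding wc4_def wc6_def disc_def wb2_def wb4_def wb6_def wb8_def
    by (intro local_ring_intros; blast)+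
qed

text \<open>
  An integral equation of discriminant valuation 0 is automatically minimal, because the
  discriminant of an integral equation is regular.
\<close>

lemma good_reduction_iff:
  fixes E :: "'k::field poly fract weierstrass"
  assumes "elliptic_curve E"
  shows "good_reduction E s \<longleftrightarrow>
    (\<exists>W. weierstrass_equation_of E W \<and> integral_at s W \<and> point_val s (disc W) = 0)"
proof
  assume "\<exists>W. weierstrass_equation_of E W \<and> integral_at s W \<and> point_val s (disc W) = 0"
  then obtain W where W: "weierstrass_equation_of E W" "integral_at s W" "point_val s (disc W) = 0" by blast
  have "point_val s (disc W') \<ge> 0" if "weierstrass_equation_of E W'" "integral_at s W'" for W'
    using integral_at_invariants(3)[OF that(2)] weierstrass_equation_of_disc_nonzero[OF that(1)] assms
    by (simp add: local_ring_iff elliptic_curve_def)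
  with W show "good_reduction E s" unfolding good_reduction_def minimal_equation_at_def by auto
qed (auto simp: good_reduction_def minimal_equation_at_def)

lemma point_val_disc_if_equation:
  fixes E :: "'k::field poly fract weierstrass"
  assumes "elliptic_curve E" "weierstrass_equation_of E W"
  shows "12 dvd point_val s (disc E) - point_val s (disc W)"
proof -
  obtain u r t v where u: "u \<noteq> 0" "W = change_coords u r t v E"
    using assms(2) unfolding weierstrass_equation_of_def by blast
  have "disc E = u ^ 12 * disc W" using change_coords_disc[OF u] by simp
  moreover have "disc W \<noteq> 0" using assms weierstrass_equation_of_disc_nonzero by (auto simp: elliptic_curve_def)
  ultimately have "point_val s (disc E) = 12 * point_val s u + point_val s (disc W)"
    using u by (simp add: point_val_mult point_val_power)
  then show ?thesis by simp
qed

text \<open>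
  A change of coordinates multiplies the discriminant by a 12th power, so a
  valuation that is not a multiple of 12 rules out an equation of unit discriminant.
\<close>

lemma bad_reduction_if_not_dvd:
  assumes "elliptic_curve E" "\<not> 12 dvd point_val s (disc E)"
  shows "s \<in> bad_points E"
  using assms(2) point_val_disc_if_equation[OF assms(1)]
  by (metis (mono_tags, lifting) assms(1) bad_points_def diff_zero good_reduction_iff mem_Collect_eq)

text \<open>
  The discriminant of \<open>y\<^sup>2 = x\<^sup>3 + A x + B\<close> without its factor \<open>-16\<close>.
\<close>

definition short_disc :: "'k::field poly \<Rightarrow> 'k poly \<Rightarrow> 'k poly" where
  "short_disc A B = smult 4 (A ^ 3) + smult 27 (B ^ 2)"

abbreviation short_poly :: "'k::field poly \<Rightarrow> 'k poly \<Rightarrow> 'k poly fract weierstrass" where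
  "short_poly A B \<equiv> short (to_fract A) (to_fract B)"

lemma disc_short_poly: "disc (short_poly A B) = const_fun (- 16) * to_fract (short_disc A B)"
  by (simp add: short_invariants short_disc_def to_fract_smult to_fract_power const_fun_hom const_fun_numeral)

lemma small_numerals_nonzero:
  assumes "(2::'k::field) \<noteq> 0" "(3::'k) \<noteq> 0"
  shows "(4::'k) \<noteq> 0" "(16::'k) \<noteq> 0" "(27::'k) \<noteq> 0" "(48::'k) \<noteq> 0" "(864::'k) \<noteq> 0"
proof -
  have "(4::'k) = 2 ^ 2" "(16::'k) = 2 ^ 4" "(27::'k) = 3 ^ 3" "(48::'k) = 2 ^ 4 * 3" "(864::'k) = 2 ^ 5 * 3 ^ 3"
    by simp_all
  then show "(4::'k) \<noteq> 0" "(16::'k) \<noteq> 0" "(27::'k) \<noteq> 0" "(48::'k) \<noteq> 0" "(864::'k) \<noteq> 0"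
    using assms by (metis mult_eq_0_iff power_eq_0_iff)+
qed

text \<open>
  Here \<open>n\<close> is the valuation of the scaling factor \<open>u\<close> leading to an integral equation of unit
  discriminant. Since \<open>wc4\<close> and \<open>wc6\<close> have weights 4 and 6, do not depend on the translation part
  of the coordinate change, and are \<open>A\<close> and \<open>B\<close> up to units, their integrality bounds the orders of
  \<open>A\<close> and \<open>B\<close>.
\<close>

lemma good_reduction_divisibility:
  fixes E :: "'k::field poly fract weierstrass"
  assumes two: "(2::'k) \<noteq> 0" and three: "(3::'k) \<noteq> 0"
    and "elliptic_curve E" "weierstrass_equation_of E (short_poly A B)" "good_reduction E s"
  obtains n where "point_ord s (short_disc A B) = 12 * n"
    "A \<noteq> 0 \<Longrightarrow> 4 * n \<le> point_ord s A" "B \<noteq> 0 \<Longrightarrow> 6 * n \<le> point_ord s B"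
proof -
  note nz = small_numerals_nonzero[OF two three]
  obtain W where W: "weierstrass_equation_of E W" "integral_at s W" "point_val s (disc W) = 0"
    using assms good_reduction_iff by blast
  have "weierstrass_equation_of (short_poly A B) W"
    using assms(4) W(1) weierstrass_equation_of_sym weierstrass_equation_of_trans by blast
  then obtain u r t v where u: "u \<noteq> 0" "W = change_coords u r t v (short_poly A B)"
    unfolding weierstrass_equation_of_def by blast
  have dW: "disc W \<noteq> 0" using W(1) assms weierstrass_equation_of_disc_nonzero by (auto simp: elliptic_curve_def)
  have "const_fun (- 16) * to_fract (short_disc A B) = u ^ 12 * disc W"
    using change_coords_disc[OF u] by (simp add: disc_short_poly)
  moreover from this have "short_disc A B \<noteq> 0" using u dW by auto
  ultimately have "point_ord s (short_disc A B) = 12 * point_val s u"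
    using arg_cong[of _ _ "point_val s"] u dW W(3) nz
    by (metis (no_types, lifting) add_cancel_left_left add_cancel_right_right const_fun_eq_0_iff neg_equal_0_iff_equal
        of_nat_numeral point_val_const_fun point_val_mult point_val_power point_val_to_fract power_not_zero to_fract_eq_0_iff)
  moreover have "4 * point_val s u \<le> point_ord s A" if "A \<noteq> 0"
  proof -
    have eq: "u ^ 4 * wc4 W = const_fun (- 48) * to_fract A"
      using change_coords_wc4[OF u] by (simp add: short_invariants const_fun_hom const_fun_numeral)
    then have "wc4 W \<noteq> 0" using that nz by auto
    then have "4 * point_val s u + point_val s (wc4 W) = point_ord s A"
      using arg_cong[OF eq, of "point_val s"] u that nz
      by (simp add: point_val_mult point_val_power point_val_const_fun point_val_to_fract)
    then show ?thesis using integral_at_invariants(1)[OF W(2)] \<open>wc4 W \<noteq> 0\<close> by (simp add: local_ring_iff)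
  qed
  moreover have "6 * point_val s u \<le> point_ord s B" if "B \<noteq> 0"
  proof -
    have eq: "u ^ 6 * wc6 W = const_fun (- 864) * to_fract B"
      using change_coords_wc6[OF u] by (simp add: short_invariants const_fun_hom const_fun_numeral)
    then have "wc6 W \<noteq> 0" using that nz by auto
    then have "6 * point_val s u + point_val s (wc6 W) = point_ord s B"
      using arg_cong[OF eq, of "point_val s"] u that nz
      by (simp add: point_val_mult point_val_power point_val_const_fun point_val_to_fract)
    then show ?thesis using integral_at_invariants(2)[OF W(2)] \<open>wc6 W \<noteq> 0\<close> by (simp add: local_ring_iff)
  qed
  ultimately show thesis by (rule that)
qed

lemma polynomial_equation_exists:
  fixes E :: "'k::field poly fract weierstrass"
  assumes two: "(2::'k) \<noteq> 0" and three: "(3::'k) \<noteq> 0"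
  obtains A B where "weierstrass_equation_of E (short_poly A B)"
proof -
  have "(2::'k poly fract) \<noteq> 0" "(3::'k poly fract) \<noteq> 0"
    using two three by (metis const_fun_eq_0_iff const_fun_numeral)+
  then obtain a b where E: "weierstrass_equation_of E (short a b)" by (rule short_equation_exists)
  obtain p q where a: "a = Fract p q" "q \<noteq> 0" by (cases a)
  obtain p' q' where b: "b = Fract p' q'" "q' \<noteq> 0" by (cases b)
  define v where "v = to_fract (q * q')"
  have v: "v \<noteq> 0" using a b by (simp add: v_def)
  have "a / (1 / v) ^ 4 = to_fract (p * q ^ 3 * q' ^ 4)" "b / (1 / v) ^ 6 = to_fract (p' * q ^ 6 * q' ^ 5)"
    using a b by (simp_all add: Fract_conv_to_fract v_def to_fract_power field_simps power_numeral_reduce)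
  then have "weierstrass_equation_of (short a b) (short_poly (p * q ^ 3 * q' ^ 4) (p' * q ^ 6 * q' ^ 5))"
    unfolding weierstrass_equation_of_def using v
    by (intro exI[of _ "1 / v"] exI[of _ 0]) (simp add: change_coords_short)
  with E that show thesis by (blast intro: weierstrass_equation_of_trans)
qed

text \<open>
  Because \<open>k[T]\<close> is a principal ideal domain, one equation can be minimal at all affine points at
  once: take one whose discriminant has least degree. If its discriminant vanished at a point \<open>a\<close> of
  good reduction, a power of \<open>T - a\<close> could be scaled away.
\<close>

lemma minimal_polynomial_equation_exists:
  fixes E :: "'k::field poly fract weierstrass"
  assumes two: "(2::'k) \<noteq> 0" and three: "(3::'k) \<noteq> 0" and E: "elliptic_curve E"
  obtains A B where "weierstrass_equation_of E (short_poly A B)" "short_disc A B \<noteq> 0"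
    "\<And>a. good_reduction E (Affine a) \<Longrightarrow> poly (short_disc A B) a \<noteq> 0"
proof -
  define M where "M = (\<lambda>n. \<exists>A B. weierstrass_equation_of E (short_poly A B) \<and> degree (short_disc A B) = n)"
  have "\<exists>n. M n" using polynomial_equation_exists[OF two three, of E] unfolding M_def by metis
  then obtain n where n: "M n" "\<And>m. m < n \<Longrightarrow> \<not> M m" using exists_least_iff[of M] by blast
  then obtain A B where AB: "weierstrass_equation_of E (short_poly A B)" "degree (short_disc A B) = n"
    unfolding M_def by blast
  have nz: "short_disc A B \<noteq> 0"
    using weierstrass_equation_of_disc_nonzero[OF AB(1)] E by (auto simp: elliptic_curve_def disc_short_poly)
  have "poly (short_disc A B) a \<noteq> 0" if good: "good_reduction E (Affine a)" for a
  proof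
    assume "poly (short_disc A B) a = 0"
    then have ord: "order a (short_disc A B) \<noteq> 0" using nz order_root by blast
    obtain k where k: "point_ord (Affine a) (short_disc A B) = 12 * k"
      "A \<noteq> 0 \<Longrightarrow> 4 * k \<le> point_ord (Affine a) A" "B \<noteq> 0 \<Longrightarrow> 6 * k \<le> point_ord (Affine a) B"
      using good_reduction_divisibility[OF two three E AB(1) good] by blast
    define l where "l = nat k"
    have "k > 0" using ord k(1) by simp
    then have kl: "k = int l" "l > 0" by (simp_all add: l_def)
    define w where "w = [:-a, 1:] ^ l"
    have w: "w \<noteq> 0" by (simp add: w_def)
    have "[:-a, 1:] ^ (4 * l) dvd A" "[:-a, 1:] ^ (6 * l) dvd B"
      using k(2,3) unfolding order_divides kl(1) point_ord.simps by linarith+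
    then have "w ^ 4 dvd A" "w ^ 6 dvd B" by (simp_all add: w_def mult.commute flip: power_mult)
    then obtain A' B' where A': "A = w ^ 4 * A'" and B': "B = w ^ 6 * B'" by (metis dvdE)
    have "change_coords (to_fract w) 0 0 0 (short_poly A B) = short_poly A' B'"
      using w by (simp add: change_coords_short A' B' to_fract_power)
    then have "weierstrass_equation_of E (short_poly A' B')"
      using AB(1) w weierstrass_equation_of_trans unfolding weierstrass_equation_of_def
      by (metis to_fract_eq_0_iff)
    then have "\<not> degree (short_disc A' B') < n" using n(2) unfolding M_def by blast
    moreover have eq: "short_disc A B = w ^ 12 * short_disc A' B'"
      by (simp add: short_disc_def A' B' power_mult_distrib algebra_simps flip: power_mult)
    then have "short_disc A' B' \<noteq> 0" using nz by auto
    then have "n = 12 * l + degree (short_disc A' B')"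
      using w unfolding AB(2)[symmetric] eq by (simp add: degree_mult_eq degree_power_eq w_def)
    ultimately show False using kl by simp
  qed
  with AB(1) nz that show thesis by blast
qed

section \<open>Lower bounds for the number of bad points\<close>

text \<open>
  The factor 6912 is \<open>48\<^sup>3 / 16\<close>, from \<open>wc4 = -48 A\<close> and the factor \<open>-16\<close> of the discriminant.
\<close>

lemma constant_j_if_cube_proportional:
  fixes E :: "'k::field poly fract weierstrass"
  assumes two: "(2::'k) \<noteq> 0" and three: "(3::'k) \<noteq> 0"
    and "weierstrass_equation_of E (short_poly A B)" "short_disc A B \<noteq> 0"
    and A3: "A ^ 3 = smult x (short_disc A B)"
  shows "constant_j E"
proof -
  note nz = small_numerals_nonzero[OF two three]
  define D where "D = to_fract (short_disc A B)"
  have D: "D \<noteq> 0" using assms(4) by (simp add: D_def)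
  have "wc4 (short_poly A B) ^ 3 = (- 48) ^ 3 * to_fract A ^ 3"
    by (simp only: short_invariants power_mult_distrib)
  also have "to_fract A ^ 3 = const_fun x * D"
    using A3 by (simp add: D_def to_fract_smult flip: to_fract_power)
  also have "(- 48) ^ 3 * (const_fun x * D) = const_fun (6912 * x) * (const_fun (- 16) * D)"
    by (simp add: const_fun_hom const_fun_numeral)
  finally have "j_invariant (short_poly A B) = const_fun (6912 * x)"
    using D nz by (simp add: j_invariant_def disc_short_poly flip: D_def)
  then show ?thesis
    using weierstrass_equation_of_j_invariant[OF assms(3)] by (simp add: constant_j_def)
qed

text \<open>
  In a minimal polynomial equation the roots of the discriminant are bad points. If infinity is among
  the two allowed bad points, there is at most one root; otherwise there may be two, and good
  reduction at infinity supplies the degree bounds needed to move one of them to infinity.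
\<close>

lemma constant_j_if_bad_at_most_two:
  fixes E :: "'k::alg_closed_field poly fract weierstrass"
  assumes two: "(2::'k) \<noteq> 0" and three: "(3::'k) \<noteq> 0" and E: "elliptic_curve E"
    and bad: "bad_points E \<subseteq> {s, t}"
  shows "constant_j E"
proof -
  obtain A B where AB: "weierstrass_equation_of E (short_poly A B)" "short_disc A B \<noteq> 0"
    and good: "\<And>a. good_reduction E (Affine a) \<Longrightarrow> poly (short_disc A B) a \<noteq> 0"
    using minimal_polynomial_equation_exists[OF two three E] by blast
  let ?D = "short_disc A B"
  have one_root: "\<exists>x. A ^ 3 = smult x ?D"
    if D: "?D = smult c ([:-a, 1:] ^ m)" and c: "c \<noteq> 0" for c a m
  proof -
    obtain x i where x: "A = smult x ([:-a, 1:] ^ i)" "x \<noteq> 0 \<Longrightarrow> 3 * i = m"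
      using weighted_homogeneous_if_discriminant_has_one_root[OF two three D[unfolded short_disc_def] c] by blast
    have "A ^ 3 = smult (x ^ 3) ([:-a, 1:] ^ m)"
      unfolding x(1) using x(2) by (cases "x = 0") (auto simp: smult_power mult.commute simp flip: power_mult)
    also have "\<dots> = smult (x ^ 3 / c) ?D"
      unfolding D using c by simp
    finally have "A ^ 3 = smult (x ^ 3 / c) ?D" .
    then show ?thesis by blast
  qed
  have roots: "Affine a \<in> {s, t}" if "poly ?D a = 0" for a
    using good that bad by (auto simp: bad_points_def)
  have "\<exists>x. A ^ 3 = smult x ?D"
  proof (cases "Infinity \<in> {s, t}")
    case True
    then obtain a where "\<And>x. poly ?D x = 0 \<Longrightarrow> x = a \<or> x = a"
      using roots by (cases s; cases t) auto
    then obtain c m n where "c \<noteq> 0" "?D = smult c ([:-a, 1:] ^ m * [:-a, 1:] ^ n)"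
      using factorization_if_roots_in_pair[OF AB(2)] by metis
    then show ?thesis using one_root[of c a "m + n"] by (simp add: power_add)
  next
    case False
    then obtain a b where st: "s = Affine a" "t = Affine b" by (cases s; cases t) auto
    obtain c m n where D: "c \<noteq> 0" "?D = smult c ([:-a, 1:] ^ m * [:-b, 1:] ^ n)" "a = b \<Longrightarrow> n = 0"
      using factorization_if_roots_in_pair[OF AB(2), of a b] roots st by auto
    show ?thesis
    proof (cases "a = b")
      case True
      then show ?thesis using D one_root[of c a m] by simp
    next
      case False
      have "good_reduction E Infinity" using bad st by (auto simp: bad_points_def)
      from good_reduction_divisibility[OF two three E AB(1) this]
      obtain k where k: "point_ord Infinity ?D = 12 * k"
        "A \<noteq> 0 \<Longrightarrow> 4 * k \<le> point_ord Infinity A" "B \<noteq> 0 \<Longrightarrow> 6 * k \<le> point_ord Infinity B" by blast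
      define d where "d = nat (- k)"
      have kd: "k = - int d" using k(1) by (simp add: d_def)
      have "degree A \<le> 4 * d" using k(2) unfolding kd by (cases "A = 0") auto
      moreover have "degree B \<le> 6 * d" using k(3) unfolding kd by (cases "B = 0") auto
      moreover have "m + n = 12 * d"
        using k(1) D unfolding kd by (simp add: degree_mult_eq degree_power_eq)
      ultimately obtain x where x: "A ^ 3 = smult x ([:-a, 1:] ^ m * [:-b, 1:] ^ n)"
        using cube_proportional_to_discriminant_with_two_roots[OF two three D(2)[unfolded short_disc_def] D(1) False]
        by blast
      have "A ^ 3 = smult (x / c) ?D" unfolding D(2) x using D(1) by simp
      then show ?thesis by blast
    qed
  qed
  then show ?thesis using constant_j_if_cube_proportional[OF two three AB] by blast
qed

text \<open>
  With a single bad point \<open>a\<close>, good reduction at infinity forces the discriminant to be a multiple of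
  \<open>(T - a) ^ (12 d)\<close>, so that \<open>A\<close> and \<open>B\<close> are multiples of \<open>(T - a) ^ (4 d)\<close> and \<open>(T - a) ^ (6 d)\<close>, and
  scaling by \<open>(T - a) ^ d\<close> makes both constant. If the bad point is infinity, the discriminant is
  constant and \<open>d = 0\<close>.
\<close>

lemma constant_curve_if_bad_at_most_one:
  fixes E :: "'k::alg_closed_field poly fract weierstrass"
  assumes two: "(2::'k) \<noteq> 0" and three: "(3::'k) \<noteq> 0" and E: "elliptic_curve E"
    and bad: "bad_points E \<subseteq> {s}"
  shows "constant_curve E"
proof -
  obtain A B where AB: "weierstrass_equation_of E (short_poly A B)" "short_disc A B \<noteq> 0"
    and good: "\<And>a. good_reduction E (Affine a) \<Longrightarrow> poly (short_disc A B) a \<noteq> 0"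
    using minimal_polynomial_equation_exists[OF two three E] by blast
  let ?D = "short_disc A B"
  have roots: "Affine a = s" if "poly ?D a = 0" for a
    using good that bad by (auto simp: bad_points_def)
  obtain a c d where D: "c \<noteq> 0" "?D = smult c ([:-a, 1:] ^ (12 * d))"
  proof (cases s)
    case Infinity
    then have "degree ?D = 0" using roots alg_closed_imp_poly_has_root by blast
    then obtain c where "?D = [:c:]" by (rule degree_eq_zeroE)
    then show thesis using that[of c 0 0] AB(2) by simp
  next
    case (Affine a)
    obtain c m where D: "c \<noteq> 0" "?D = smult c ([:-a, 1:] ^ m)"
      using factorization_if_roots_in_pair[OF AB(2), of a a] roots Affine
      by (metis P1_point.inject mult.right_neutral power_0)
    have "good_reduction E Infinity" using bad Affine by (auto simp: bad_points_def)
    from good_reduction_divisibility[OF two three E AB(1) this]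
    obtain k where "point_ord Infinity ?D = 12 * k" by blast
    then have "- int m = 12 * k" using D by (simp add: degree_power_eq)
    then have "m = 12 * nat (- k)" by simp
    with D that show thesis by blast
  qed
  obtain x i y j where xy: "A = smult x ([:-a, 1:] ^ i)" "B = smult y ([:-a, 1:] ^ j)"
    "x \<noteq> 0 \<Longrightarrow> 3 * i = 12 * d" "y \<noteq> 0 \<Longrightarrow> 2 * j = 12 * d"
    using weighted_homogeneous_if_discriminant_has_one_root[OF two three D(2)[unfolded short_disc_def] D(1)] by blast
  define w where "w = [:-a, 1:] ^ d"
  have w: "w \<noteq> 0" by (simp add: w_def)
  have "A = smult x (w ^ 4)" "B = smult y (w ^ 6)"
    using xy by (cases "x = 0"; cases "y = 0"; simp add: w_def mult.commute flip: power_mult)+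
  then have "change_coords (to_fract w) 0 0 0 (short_poly A B) = short (const_fun x) (const_fun y)"
    using w by (simp add: change_coords_short to_fract_smult to_fract_power)
  then have "weierstrass_equation_of E (short (const_fun x) (const_fun y))"
    using AB(1) w weierstrass_equation_of_trans unfolding weierstrass_equation_of_def
    by (metis to_fract_eq_0_iff)
  moreover have "0 = const_fun (0::'k)" by simp
  then have "set_weierstrass (short (const_fun x) (const_fun y)) \<subseteq> range const_fun"
    unfolding short_def by auto
  ultimately show ?thesis unfolding constant_curve_def by blast
qed

section \<open>Curves attaining the bounds\<close>

text \<open>
  The Legendre family \<open>y\<^sup>2 = x (x - 1) (x - T)\<close>.
\<close>

definition legendre_curve :: "'k::field poly fract weierstrass" where
  "legendre_curve = Weierstrass 0 (to_fract [:-1, -1:]) 0 (to_fract [:0, 1:]) 0"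

lemma legendre_invariants:
  "disc (legendre_curve :: 'k::field poly fract weierstrass) =
     const_fun 16 * (to_fract [:0, 1:] ^ 2 * to_fract [:-1, 1:] ^ 2)"
  "wc4 (legendre_curve :: 'k poly fract weierstrass) = const_fun 16 * to_fract [:1, -1, 1:]"
proof -
  define T :: "'k poly fract" where "T = to_fract [:0, 1:]"
  have 1: "to_fract [:-1, -1:] = - 1 - T" "to_fract [:-1, 1:] = T - 1" "to_fract [:1, -1, 1:] = T ^ 2 - T + 1"
    by (simp_all add: T_def power2_eq_square flip: to_fract_1 to_fract_diff to_fract_uminus to_fract_mult to_fract_add one_pCons)
      (simp_all add: one_pCons)
  show "disc (legendre_curve :: 'k poly fract weierstrass) =
     const_fun 16 * (to_fract [:0, 1:] ^ 2 * to_fract [:-1, 1:] ^ 2)"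
    unfolding 1 const_fun_numeral
    by (simp add: legendre_curve_def disc_def wb2_def wb4_def wb6_def wb8_def 1 flip: T_def) algebra
  show "wc4 (legendre_curve :: 'k poly fract weierstrass) = const_fun 16 * to_fract [:1, -1, 1:]"
    unfolding 1 const_fun_numeral
    by (simp add: legendre_curve_def wc4_def wb2_def wb4_def 1 flip: T_def) algebra
qed

lemma local_ring_to_fract: "to_fract p \<in> local_ring (Affine a)"
  unfolding local_ring_iff by (cases "p = 0") (auto simp: point_val_to_fract)

text \<open>
  The discriminant \<open>16 T\<^sup>2 (T - 1)\<^sup>2\<close> has valuation 2 at 0 and at 1 and valuation -4 at infinity, none
  of which is divisible by 12. The \<open>j\<close>-invariant has a pole at 0: there \<open>wc4\<close> takes the value 16.
\<close>

lemma legendre_curve_sharp: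
  assumes two: "(2::'k::field) \<noteq> 0"
  defines "E \<equiv> (legendre_curve :: 'k poly fract weierstrass)"
  shows "elliptic_curve E" "\<not> constant_j E" "bad_points E = {Affine 0, Affine 1, Infinity}"
proof -
  have "(16::'k) = 2 ^ 4" by simp
  then have n16: "(16::'k) \<noteq> 0" using two by (metis power_eq_0_iff)
  show ell: "elliptic_curve E"
    using n16 by (simp add: E_def elliptic_curve_def legendre_invariants)
  have val: "point_val s (disc E) = 2 * point_ord s [:0, 1:] + 2 * point_ord s [:-1, 1:]" for s
    using n16 by (simp add: E_def legendre_invariants point_val_mult point_val_power point_val_const_fun point_val_to_fract)
  have ord: "order a [:-b, 1:] = (if a = b then 1 else 0)" for a b :: 'k
    using order_power_n_n[of b 1] by (auto simp: order_0I)
  have ord0: "order a [:0, 1:] = (if a = 0 then 1 else 0)" for a :: 'k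
    using ord[of a 0] by simp
  have "Affine 0 \<in> bad_points E" "Affine 1 \<in> bad_points E" "Infinity \<in> bad_points E"
    by (rule bad_reduction_if_not_dvd[OF ell], simp add: val ord ord0)+
  moreover have "Affine a \<notin> bad_points E" if "a \<noteq> 0" "a \<noteq> 1" for a
  proof -
    have "integral_at (Affine a) E"
      using local_ring_to_fract[of 0 a] by (auto simp: E_def legendre_curve_def integral_at_def local_ring_to_fract simp del: local_ring.simps)
    moreover have "point_val (Affine a) (disc E) = 0" using that by (simp add: val ord ord0)
    ultimately show ?thesis
      using weierstrass_equation_of_refl by (auto simp: bad_points_def good_reduction_iff[OF ell])
  qed
  ultimately have "s \<in> bad_points E \<longleftrightarrow> s \<in> {Affine 0, Affine 1, Infinity}" for s
    by (cases s) auto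
  then show "bad_points E = {Affine 0, Affine 1, Infinity}" by blast
  show "\<not> constant_j E"
  proof
    assume "constant_j E"
    then obtain c where "wc4 E ^ 3 / disc E = const_fun c" by (auto simp: constant_j_def j_invariant_def)
    then have "wc4 E ^ 3 = const_fun c * disc E" using ell by (simp add: elliptic_curve_def field_simps)
    then have "to_fract (smult 16 [:1, -1, 1:] ^ 3) = to_fract (smult c (smult 16 ([:0, 1:] ^ 2 * [:-1, 1:] ^ 2)))"
      unfolding E_def legendre_invariants to_fract_power to_fract_smult to_fract_mult by simp
    then have "poly (smult 16 [:1, -1, 1:] ^ 3) 0 = poly (smult c (smult 16 ([:0, 1:] ^ 2 * [:-1, 1:] ^ 2))) 0"
      unfolding to_fract_eq_iff by simp
    then have "(16::'k) ^ 3 = 0" by simp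
    then show False using n16 by (metis power_eq_0_iff)
  qed
qed

lemma bad_points_constant_curve:
  assumes E: "elliptic_curve E" "constant_curve E"
  shows "bad_points E = {}"
proof -
  obtain W where W: "weierstrass_equation_of E W" "set_weierstrass W \<subseteq> range const_fun"
    using E(2) unfolding constant_curve_def by blast
  have int: "integral_at s W" for s
    using W(2) local_ring_const_fun by (auto simp: integral_at_def simp del: local_ring.simps)
  obtain a1 a2 a3 a4 a6 where "W = Weierstrass (const_fun a1) (const_fun a2) (const_fun a3) (const_fun a4) (const_fun a6)"
    using W(2) by (cases W) auto
  then have d: "disc W = const_fun (disc (Weierstrass a1 a2 a3 a4 a6))"
    by (simp add: disc_def wb2_def wb4_def wb6_def wb8_def const_fun_hom const_fun_power const_fun_numeral)
  have "disc W \<noteq> 0" using W(1) E weierstrass_equation_of_disc_nonzero by (auto simp: elliptic_curve_def)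
  then have "point_val s (disc W) = 0" for s
    unfolding d by (intro point_val_const_fun) auto
  then have "good_reduction E s" for s using W(1) int good_reduction_iff[OF E(1)] by blast
  then show ?thesis by (simp add: bad_points_def)
qed

text \<open>
  The curve \<open>y\<^sup>2 = x\<^sup>3 + T\<close> has \<open>j\<close>-invariant 0. Its discriminant \<open>-432 T\<^sup>2\<close> has valuations 2 and -2
  at 0 and infinity, and a constant curve would have good reduction there.
\<close>

lemma isotrivial_curve_sharp:
  assumes two: "(2::'k::field) \<noteq> 0" and three: "(3::'k) \<noteq> 0"
  defines "E \<equiv> short_poly 0 [:0, 1 :: 'k:]"
  shows "elliptic_curve E" "\<not> constant_curve E" "bad_points E = {Affine 0, Infinity}"
proof -
  note nz = small_numerals_nonzero[OF two three]
  have disc: "disc E = const_fun (- 432) * to_fract [:0, 1:] ^ 2"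
    unfolding E_def disc_short_poly
    by (simp add: short_disc_def to_fract_smult to_fract_power const_fun_hom const_fun_numeral)
  have "(432::'k) = 16 * 27" by simp
  then have n432: "(432::'k) \<noteq> 0" using nz by (metis mult_eq_0_iff)
  show ell: "elliptic_curve E" using n432 by (simp add: elliptic_curve_def disc)
  have val: "point_val s (disc E) = 2 * point_ord s [:0, 1:]" for s
    using n432 by (simp add: disc point_val_mult point_val_power point_val_const_fun point_val_to_fract)
  have ord0: "order a [:0, 1:] = (if a = 0 then 1 else 0)" for a :: 'k
    using order_power_n_n[of a 1] by (auto simp: order_0I)
  have "Affine 0 \<in> bad_points E" "Infinity \<in> bad_points E"
    by (rule bad_reduction_if_not_dvd[OF ell], simp add: val ord0)+
  moreover have "Affine a \<notin> bad_points E" if "a \<noteq> 0" for a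
  proof -
    have "integral_at (Affine a) E"
      using local_ring_to_fract[of 0 a] by (auto simp: E_def short_def integral_at_def local_ring_to_fract simp del: local_ring.simps)
    moreover have "point_val (Affine a) (disc E) = 0" using that by (simp add: val ord0)
    ultimately show ?thesis
      using weierstrass_equation_of_refl by (auto simp: bad_points_def good_reduction_iff[OF ell])
  qed
  ultimately have "s \<in> bad_points E \<longleftrightarrow> s \<in> {Affine 0, Infinity}" for s
    by (cases s) auto
  then show "bad_points E = {Affine 0, Infinity}" by blast
  then show "\<not> constant_curve E" using bad_points_constant_curve[OF ell] by auto
qed

section \<open>The bounds and their sharpness\<close>

lemma subset_of_card_or_card_le:
  "(\<exists>S. S \<subseteq> X \<and> finite S \<and> card S = Suc n) \<or> finite X \<and> card X \<le> n"
  by (metis card.infinite finite_subset infinite_arbitrarily_large not_less_eq_eq obtain_subset_with_card_n)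

lemma subset_pair_if_card_le_2:
  assumes "finite X" "card X \<le> 2"
  obtains s t where "X \<subseteq> {s, t}"
proof (cases "X = {}")
  case False
  then obtain s where s: "s \<in> X" by blast
  then have "card (X - {s}) \<le> Suc 0" using assms by (simp add: card_Diff_singleton)
  then have "\<forall>x\<in>X - {s}. \<forall>y\<in>X - {s}. x = y" using assms by (simp add: card_le_Suc0_iff_eq)
  then have "\<exists>t. X \<subseteq> {s, t}" by (cases "X - {s} = {}") blast+
  then show thesis using that by blast
qed (use that in blast)

theorem theorem1:
  assumes "CHAR('k :: alg_closed_field) \<noteq> 2" and "CHAR('k) \<noteq> 3"
  shows "(\<forall>E :: 'k poly fract weierstrass. elliptic_curve E \<and> \<not> constant_j E \<longrightarrow>
            (\<exists>S. S \<subseteq> bad_points E \<and> finite S \<and> card S = 3))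
       \<and> (\<forall>E :: 'k poly fract weierstrass. elliptic_curve E \<and> \<not> constant_curve E \<longrightarrow>
            (\<exists>S. S \<subseteq> bad_points E \<and> finite S \<and> card S = 2))
       \<and> (\<exists>E :: 'k poly fract weierstrass. elliptic_curve E \<and> \<not> constant_j E \<and>
            card (bad_points E) = 3)
       \<and> (\<exists>E :: 'k poly fract weierstrass. elliptic_curve E \<and> \<not> constant_curve E \<and>
            card (bad_points E) = 2)"
proof -
  have prime_3: "prime (3::nat)" by simp
  have "\<not> CHAR('k) dvd 2" "\<not> CHAR('k) dvd 3"
    using assms CHAR_not_1'[where 'a = 'k] two_is_prime_nat prime_3
    unfolding prime_nat_iff by auto
  then have "of_nat 2 \<noteq> (0::'k)" "of_nat 3 \<noteq> (0::'k)"
    unfolding of_nat_eq_0_iff_char_dvd by auto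
  then have two: "(2::'k) \<noteq> 0" and three: "(3::'k) \<noteq> 0" by simp_all
  show ?thesis
  proof (intro conjI allI impI)
    fix E :: "'k poly fract weierstrass"
    assume E: "elliptic_curve E \<and> \<not> constant_j E"
    show "\<exists>S. S \<subseteq> bad_points E \<and> finite S \<and> card S = 3"
    proof (rule ccontr)
      assume "\<not> ?thesis"
      then have "finite (bad_points E)" "card (bad_points E) \<le> 2"
        using subset_of_card_or_card_le[of "bad_points E" 2] by auto
      then obtain s t where "bad_points E \<subseteq> {s, t}" using subset_pair_if_card_le_2 by blast
      then show False using E constant_j_if_bad_at_most_two[OF two three] by blast
    qed
  next
    fix E :: "'k poly fract weierstrass"
    assume E: "elliptic_curve E \<and> \<not> constant_curve E"
    show "\<exists>S. S \<subseteq> bad_points E \<and> finite S \<and> card S = 2"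
    proof (rule ccontr)
      assume "\<not> ?thesis"
      then have "finite (bad_points E)" "card (bad_points E) \<le> Suc 0"
        using subset_of_card_or_card_le[of "bad_points E" 1] by (auto simp: numeral_2_eq_2)
      then obtain s where "bad_points E \<subseteq> {s}"
        by (metis card_le_Suc0_iff_eq insertI1 singletonD subsetI subset_singletonD)
      then show False using E constant_curve_if_bad_at_most_one[OF two three] by blast
    qed
  next
    show "\<exists>E :: 'k poly fract weierstrass. elliptic_curve E \<and> \<not> constant_j E \<and> card (bad_points E) = 3"
      using legendre_curve_sharp[OF two] by (intro exI[of _ legendre_curve]) simp
    show "\<exists>E :: 'k poly fract weierstrass. elliptic_curve E \<and> \<not> constant_curve E \<and> card (bad_points E) = 2"
      using isotrivial_curve_sharp[OF two three] by (intro exI[of _ "short_poly 0 [:0, 1:]"]) simp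
  qed
qed

end
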